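(* Let $A,B$ be Banach algebras, $X$ a Banach $A$--$B$ bimodule, and $\sigma=(\sigma_A,\sigma_B)\in\operatorname{Aut}(A)\times\operatorname{Aut}(B)$. If the twisted triangular Banach algebra $\mathcal{T}_\sigma(A,B;X)$ is amenable, then $X=0$ and both $A$ and $B$ are amenable.
   Context: Fix a scalar field $\mathbb{K}\in\{\mathbb{R},\mathbb{C}\}$. All algebras are Banach $\mathbb{K}$-algebras, all homomorphisms (in particular automorphisms) are bounded and $\mathbb{K}$-linear. A Banach $A$--$B$ bimodule $X$ is a Banach space with commuting bounded left $A$-action and right $B$-action. For $\sigma=(\sigma_A,\sigma_B)\in\operatorname{Aut}(A)\times\operatorname{Aut}(B)$, the twisted triangular Banach algebra $\mathcal{T}_\sigma(A,B;X)$ is the space of matrices $\begin{bmatrix}a&x\\0&b\end{bmatrix}$ with $a\in A$, $x\in X$, $b\in B$, with norm $\|a\|+\|x\|+\|b\|$ and multiplication $$\begin{bmatrix}a&x\\0&b\end{bmatrix}\cdot_\sigma\begin{bmatrix}a'&x'\\0&b'\end{bmatrix}=\begin{bmatrix}aa'&\sigma_A(a)\cdot x'+x\cdot\sigma_B(b')\\0&bb'\end{bmatrix}.$$ (The product is bounded for this norm.) A Banach algebra $A$ is amenable if every bounded derivation $D:A\to E^*$ into the dual of a Banach $A$-bimodule $E$ is inner; equivalently $H^1(A,E^* )=0$ for every Banach $A$-bimodule $E$ (continuous Hochschild cohomology). *)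

theory Defs
  imports "HOL-Analysis.Analysis" "HOL-Algebra.Module"
begin

text \<open>
  The scalar field is a set \<open>K\<close> of complex numbers, and every notion below is used with
  \<open>K = \<real>\<close> or \<open>K = UNIV\<close> only. Banach spaces have explicit carriers, because amenability
  quantifies over all Banach bimodules inside a formula. Vector spaces are HOL-Algebra modules
  over the ring \<open>scalars K\<close>. The \<open>mult\<close> field of the underlying record is meaningful for algebras
  only and \<open>one\<close> for \<open>scalars K\<close> only (algebras need not be unital).
\<close>

record 'e nspace = "(complex, 'e) module" +
  nrm :: "'e \<Rightarrow> real"

record ('a, 'b, 'e) bimod = "'e nspace" +
  lact :: "'a \<Rightarrow> 'e \<Rightarrow> 'e"
  ract :: "'e \<Rightarrow> 'b \<Rightarrow> 'e"

definition scalars :: "complex set \<Rightarrow> complex nspace" where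
  "scalars K = \<lparr>carrier = K, mult = (*), one = 1, zero = 0, add = (+), smult = (*), nrm = cmod\<rparr>"

text \<open>The case distinction is there because \<open>Metric_space\<close> requires a distance function to be
  nonnegative and symmetric off the carrier as well.\<close>

definition ndist :: "('e, 'm) nspace_scheme \<Rightarrow> 'e \<Rightarrow> 'e \<Rightarrow> real" where
  "ndist E x y =
     (if x \<in> carrier E \<and> y \<in> carrier E then nrm E (x \<ominus>\<^bsub>E\<^esub> y) else 0)"

locale banach_space = Module.module "scalars K" E
  for K :: "complex set" and E :: "('e, 'm) nspace_scheme" (structure) +
  assumes nrm_nonneg: "x \<in> carrier E \<Longrightarrow> 0 \<le> nrm E x"
    and nrm_eq_0: "x \<in> carrier E \<Longrightarrow> nrm E x = 0 \<longleftrightarrow> x = \<zero>\<^bsub>E\<^esub>"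
    and nrm_triangle: "x \<in> carrier E \<Longrightarrow> y \<in> carrier E \<Longrightarrow> nrm E (x \<oplus>\<^bsub>E\<^esub> y) \<le> nrm E x + nrm E y"
    and nrm_smult: "k \<in> K \<Longrightarrow> x \<in> carrier E \<Longrightarrow> nrm E (k \<odot>\<^bsub>E\<^esub> x) = cmod k * nrm E x"
    and complete: "Metric_space.mcomplete (carrier E) (ndist E)"

definition bounded_linear_map ::
  "complex set \<Rightarrow> ('e, 'm) nspace_scheme \<Rightarrow> ('f, 'n) nspace_scheme \<Rightarrow> ('e \<Rightarrow> 'f) \<Rightarrow> bool" where
  "bounded_linear_map K E F T \<longleftrightarrow>
     T \<in> carrier E \<rightarrow> carrier F \<and>
     (\<forall>x\<in>carrier E. \<forall>y\<in>carrier E. T (x \<oplus>\<^bsub>E\<^esub> y) = T x \<oplus>\<^bsub>F\<^esub> T y) \<and>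
     (\<forall>k\<in>K. \<forall>x\<in>carrier E. T (k \<odot>\<^bsub>E\<^esub> x) = k \<odot>\<^bsub>F\<^esub> T x) \<and>
     (\<exists>C. \<forall>x\<in>carrier E. nrm F (T x) \<le> C * nrm E x)"

definition bounded_bilinear_map ::
  "complex set \<Rightarrow> ('e, 'm) nspace_scheme \<Rightarrow> ('f, 'n) nspace_scheme \<Rightarrow> ('g, 'p) nspace_scheme
     \<Rightarrow> ('e \<Rightarrow> 'f \<Rightarrow> 'g) \<Rightarrow> bool" where
  "bounded_bilinear_map K E F G b \<longleftrightarrow>
     (\<forall>x\<in>carrier E. bounded_linear_map K F G (b x)) \<and>
     (\<forall>y\<in>carrier F. bounded_linear_map K E G (\<lambda>x. b x y)) \<and>
     (\<exists>C. \<forall>x\<in>carrier E. \<forall>y\<in>carrier F. nrm G (b x y) \<le> C * nrm E x * nrm F y)"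

text \<open>As for the triangular algebras below, whose norm need not be submultiplicative, the product
  of a Banach algebra is only required to be bounded.\<close>

definition banach_algebra :: "complex set \<Rightarrow> ('a, 'm) nspace_scheme \<Rightarrow> bool" where
  "banach_algebra K A \<longleftrightarrow>
     banach_space K A \<and>
     bounded_bilinear_map K A A A (\<lambda>a b. a \<otimes>\<^bsub>A\<^esub> b) \<and>
     (\<forall>a\<in>carrier A. \<forall>b\<in>carrier A. \<forall>c\<in>carrier A.
        (a \<otimes>\<^bsub>A\<^esub> b) \<otimes>\<^bsub>A\<^esub> c = a \<otimes>\<^bsub>A\<^esub> (b \<otimes>\<^bsub>A\<^esub> c))"

text \<open>The inverse of such a map is automatically bounded, by the open mapping theorem.\<close>

definition banach_Aut :: "complex set \<Rightarrow> ('a, 'm) nspace_scheme \<Rightarrow> ('a \<Rightarrow> 'a) set" where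
  "banach_Aut K A =
     {s. bounded_linear_map K A A s \<and>
         (\<forall>a\<in>carrier A. \<forall>b\<in>carrier A. s (a \<otimes>\<^bsub>A\<^esub> b) = s a \<otimes>\<^bsub>A\<^esub> s b) \<and>
         bij_betw s (carrier A) (carrier A)}"

definition banach_bimodule ::
  "complex set \<Rightarrow> ('a, 'm) nspace_scheme \<Rightarrow> ('b, 'n) nspace_scheme
     \<Rightarrow> ('a, 'b, 'e, 'p) bimod_scheme \<Rightarrow> bool" where
  "banach_bimodule K A B X \<longleftrightarrow>
     banach_space K X \<and>
     bounded_bilinear_map K A X X (lact X) \<and>
     bounded_bilinear_map K X B X (ract X) \<and>
     (\<forall>a\<in>carrier A. \<forall>a'\<in>carrier A. \<forall>x\<in>carrier X.
        lact X (a \<otimes>\<^bsub>A\<^esub> a') x = lact X a (lact X a' x)) \<and>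
     (\<forall>b\<in>carrier B. \<forall>b'\<in>carrier B. \<forall>x\<in>carrier X.
        ract X x (b \<otimes>\<^bsub>B\<^esub> b') = ract X (ract X x b) b') \<and>
     (\<forall>a\<in>carrier A. \<forall>b\<in>carrier B. \<forall>x\<in>carrier X.
        ract X (lact X a x) b = lact X a (ract X x b))"

text \<open>Functionals are normalised to be \<open>undefined\<close> off the carrier of \<open>E\<close>, so that equality in
  the dual is equality of functions. The actions on the dual of an \<open>A\<close>-bimodule are
  \<open>(a \<cdot> f) x = f (x \<cdot> a)\<close> and \<open>(f \<cdot> a) x = f (a \<cdot> x)\<close>.\<close>

definition dual_bimod ::
  "complex set \<Rightarrow> ('a, 'a, 'e, 'p) bimod_scheme \<Rightarrow> ('a, 'a, 'e \<Rightarrow> complex) bimod" where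
  "dual_bimod K E =
     \<lparr>carrier = {f \<in> extensional (carrier E). bounded_linear_map K E (scalars K) f},
      mult = undefined, one = undefined,
      zero = (\<lambda>x\<in>carrier E. 0),
      add = (\<lambda>f g. \<lambda>x\<in>carrier E. f x + g x),
      smult = (\<lambda>k f. \<lambda>x\<in>carrier E. k * f x),
      nrm = (\<lambda>f. SUP x\<in>{x \<in> carrier E. nrm E x \<le> 1}. cmod (f x)),
      lact = (\<lambda>a f. \<lambda>x\<in>carrier E. f (ract E x a)),
      ract = (\<lambda>f a. \<lambda>x\<in>carrier E. f (lact E a x))\<rparr>"

definition bounded_derivation ::
  "complex set \<Rightarrow> ('a, 'm) nspace_scheme \<Rightarrow> ('a, 'a, 'e, 'p) bimod_scheme \<Rightarrow> ('a \<Rightarrow> 'e) \<Rightarrow> bool" where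
  "bounded_derivation K A Y D \<longleftrightarrow>
     bounded_linear_map K A Y D \<and>
     (\<forall>a\<in>carrier A. \<forall>b\<in>carrier A. D (a \<otimes>\<^bsub>A\<^esub> b) = lact Y a (D b) \<oplus>\<^bsub>Y\<^esub> ract Y (D a) b)"

definition inner_derivation ::
  "('a, 'm) nspace_scheme \<Rightarrow> ('a, 'a, 'e, 'p) bimod_scheme \<Rightarrow> ('a \<Rightarrow> 'e) \<Rightarrow> bool" where
  "inner_derivation A Y D \<longleftrightarrow>
     (\<exists>y\<in>carrier Y. \<forall>a\<in>carrier A. D a = lact Y a y \<ominus>\<^bsub>Y\<^esub> ract Y y a)"

text \<open>
  HOL cannot quantify over types inside a formula, so the bimodules \<open>E\<close> have carriers in a type:
  the sum of an arbitrary type \<open>'u\<close> (hence no bimodule is excluded from the notion, for suitable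
  \<open>'u\<close>) and of \<open>'a \<Rightarrow> 'a \<Rightarrow> complex\<close>. The second summand makes the notion independent of \<open>'u\<close>.
  It has room for isomorphic copies of the predual modules in the usual construction of a bounded
  approximate identity and a virtual diagonal (the dual of \<open>A\<close>, and the dual of the kernel of the
  product map on the projective tensor square, a quotient of the bounded bilinear forms), and their
  existence already makes every bounded derivation into any dual bimodule inner. Without that
  summand a small type \<open>'u\<close> would make amenability vacuous.
\<close>

definition amenable :: "'u itself \<Rightarrow> complex set \<Rightarrow> ('a, 'm) nspace_scheme \<Rightarrow> bool" where
  "amenable U K A \<longleftrightarrow>
     (\<forall>(E :: ('a, 'a, 'u + ('a \<Rightarrow> 'a \<Rightarrow> complex)) bimod) D.
        banach_bimodule K A A E \<and> bounded_derivation K A (dual_bimod K E) D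
        \<longrightarrow> inner_derivation A (dual_bimod K E) D)"

text \<open>The triple \<open>(a, x, b)\<close> stands for the upper triangular matrix with diagonal \<open>a\<close>, \<open>b\<close> and
  corner \<open>x\<close>.\<close>

definition twisted_triangular ::
  "('a \<Rightarrow> 'a) \<times> ('b \<Rightarrow> 'b) \<Rightarrow> ('a, 'm) nspace_scheme \<Rightarrow> ('b, 'n) nspace_scheme
     \<Rightarrow> ('a, 'b, 'x, 'p) bimod_scheme \<Rightarrow> ('a \<times> 'x \<times> 'b) nspace" where
  "twisted_triangular \<sigma> A B X =
     \<lparr>carrier = carrier A \<times> carrier X \<times> carrier B,
      mult = (\<lambda>(a, x, b) (a', x', b').
        (a \<otimes>\<^bsub>A\<^esub> a', lact X (fst \<sigma> a) x' \<oplus>\<^bsub>X\<^esub> ract X x (snd \<sigma> b'), b \<otimes>\<^bsub>B\<^esub> b')),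
      one = undefined,
      zero = (\<zero>\<^bsub>A\<^esub>, \<zero>\<^bsub>X\<^esub>, \<zero>\<^bsub>B\<^esub>),
      add = (\<lambda>(a, x, b) (a', x', b'). (a \<oplus>\<^bsub>A\<^esub> a', x \<oplus>\<^bsub>X\<^esub> x', b \<oplus>\<^bsub>B\<^esub> b')),
      smult = (\<lambda>k (a, x, b). (k \<odot>\<^bsub>A\<^esub> a, k \<odot>\<^bsub>X\<^esub> x, k \<odot>\<^bsub>B\<^esub> b)),
      nrm = (\<lambda>(a, x, b). nrm A a + nrm X x + nrm B b)\<rparr>"

end

theory Submission
  imports Defs
begin

text \<open>
  The corner projection \<open>d (a, x, b) = x\<close> is a bounded derivation of the triangular algebra \<open>T\<close> into
  the Banach \<open>T\<close>-bimodule \<open>Y\<close>, which is \<open>X\<close> with \<open>(a, x, b)\<close> acting through \<open>\<sigma>\<^sub>A(a)\<close> on the left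
  and through \<open>\<sigma>\<^sub>B(b)\<close> on the right: this is exactly what the product of \<open>T\<close> says. Composed with
  the canonical map \<open>\<iota>\<close> into the bidual it becomes a derivation into the dual of \<open>Y\<^sup>*\<close>, so amenability
  yields \<open>\<Phi>\<close> in the bidual with \<open>\<iota> (d t) = t \<Phi> - \<Phi> t\<close> for all \<open>t\<close>. The corner element \<open>(0, x, 0)\<close>
  acts as zero on \<open>Y\<close>, hence on all its duals, and therefore \<open>\<iota> x = 0\<close>
  (\<open>amenable_derivation_vanishes\<close>): every bounded functional vanishes at \<open>x\<close>. By the Hahn-Banach
  theorem (\<open>Hahn_Banach_separation\<close>) \<open>x = 0\<close>.

  The diagonal projections are bounded homomorphisms of \<open>T\<close> onto \<open>A\<close> and onto \<open>B\<close>, and amenability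
  passes to images (\<open>amenable_image\<close>): a bimodule over the image is a bimodule over \<open>T\<close>, and a
  functional that implements the derivation composed with the projection implements the
  derivation.

  Two points take the space. The dual of a Banach bimodule has to be shown to be a Banach
  bimodule, as \<open>Y\<^sup>*\<close> is the bimodule to which amenability is applied. And amenability
  speaks of bimodules with carriers in one given type, whence every bimodule is first moved
  to an isometric copy (\<open>bimod_along\<close>, \<open>amenable_derivation\<close>); the required injections exist
  because that type contains the functions on pairs of elements of the algebra.
\<close>

section \<open>Normed spaces with explicit carriers\<close>

lemma scalars_simps [simp]:
  "carrier (scalars K) = K" "mult (scalars K) = (*)" "one (scalars K) = 1"
  "zero (scalars K) = 0" "add (scalars K) = (+)" "smult (scalars K) = (*)"
  "nrm (scalars K) = cmod"
  by (simp_all add: scalars_def)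

lemma cring_scalars:
  assumes "K = \<real> \<or> K = UNIV"
  shows "cring (scalars K)"
proof (rule cringI)
  show "abelian_group (scalars K)"
  proof (rule abelian_groupI)
    fix x assume "x \<in> carrier (scalars K)"
    then show "\<exists>y\<in>carrier (scalars K). y \<oplus>\<^bsub>scalars K\<^esub> x = \<zero>\<^bsub>scalars K\<^esub>"
      using assms by (intro bexI[of _ "- x"]) auto
  qed (use assms in auto)
  show "comm_monoid (scalars K)"
    by (rule comm_monoidI) (use assms in auto)
qed (auto simp: algebra_simps)

lemma additive_minus:
  assumes "abelian_group G" "abelian_group H" "h \<in> carrier G \<rightarrow> carrier H"
    and "\<And>x y. x \<in> carrier G \<Longrightarrow> y \<in> carrier G \<Longrightarrow> h (x \<oplus>\<^bsub>G\<^esub> y) = h x \<oplus>\<^bsub>H\<^esub> h y"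
    and "x \<in> carrier G" "y \<in> carrier G"
  shows "h (x \<ominus>\<^bsub>G\<^esub> y) = h x \<ominus>\<^bsub>H\<^esub> h y"
proof -
  interpret G: abelian_group G by fact
  interpret H: abelian_group H by fact
  have [simp]: "h z \<in> carrier H" if "z \<in> carrier G" for z
    using assms(3) that by auto
  have "h (x \<ominus>\<^bsub>G\<^esub> y) \<oplus>\<^bsub>H\<^esub> h y = h ((x \<ominus>\<^bsub>G\<^esub> y) \<oplus>\<^bsub>G\<^esub> y)"
    using assms(4)[of "x \<ominus>\<^bsub>G\<^esub> y" y] assms(5,6) by simp
  also have "\<dots> = h x"
    using assms(5,6) by (simp add: G.minus_eq G.a_assoc G.l_neg)
  finally have "h x = h (x \<ominus>\<^bsub>G\<^esub> y) \<oplus>\<^bsub>H\<^esub> h y" ..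
  then show ?thesis
    using assms(5,6) by (simp add: H.minus_eq H.a_assoc H.r_neg)
qed

locale normed_space = Module.module "scalars K" E
  for K :: "complex set" and E :: "('e, 'm) nspace_scheme" (structure) +
  assumes real_or_complex: "K = \<real> \<or> K = UNIV"
    and norm_nonneg: "x \<in> carrier E \<Longrightarrow> 0 \<le> nrm E x"
    and norm_eq_0: "x \<in> carrier E \<Longrightarrow> nrm E x = 0 \<longleftrightarrow> x = \<zero>\<^bsub>E\<^esub>"
    and norm_triangle: "x \<in> carrier E \<Longrightarrow> y \<in> carrier E \<Longrightarrow> nrm E (x \<oplus>\<^bsub>E\<^esub> y) \<le> nrm E x + nrm E y"
    and norm_smult: "k \<in> K \<Longrightarrow> x \<in> carrier E \<Longrightarrow> nrm E (k \<odot>\<^bsub>E\<^esub> x) = cmod k * nrm E x"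

lemma banach_normed_space:
  assumes "K = \<real> \<or> K = UNIV" "banach_space K E"
  shows "normed_space K E"
proof -
  interpret banach_space K E by fact
  show ?thesis
    by unfold_locales
      (use assms(1) nrm_nonneg nrm_eq_0 nrm_triangle nrm_smult in auto)
qed

context normed_space
begin

lemma of_real_scalar [simp]: "complex_of_real r \<in> K"
  using real_or_complex by auto

lemma scalar_simps [simp]:
  "0 \<in> K" "1 \<in> K" "- 1 \<in> K"
  "k \<in> K \<Longrightarrow> l \<in> K \<Longrightarrow> k + l \<in> K" "k \<in> K \<Longrightarrow> l \<in> K \<Longrightarrow> k * l \<in> K" "k \<in> K \<Longrightarrow> - k \<in> K"
  using real_or_complex by auto

lemma smult_in [simp]: "k \<in> K \<Longrightarrow> x \<in> carrier E \<Longrightarrow> k \<odot>\<^bsub>E\<^esub> x \<in> carrier E"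
  using smult_closed by simp

lemma smult_add_left: "k \<in> K \<Longrightarrow> l \<in> K \<Longrightarrow> x \<in> carrier E \<Longrightarrow>
    (k + l) \<odot>\<^bsub>E\<^esub> x = k \<odot>\<^bsub>E\<^esub> x \<oplus>\<^bsub>E\<^esub> l \<odot>\<^bsub>E\<^esub> x"
  using smult_l_distr by simp

lemma smult_smult: "k \<in> K \<Longrightarrow> l \<in> K \<Longrightarrow> x \<in> carrier E \<Longrightarrow>
    k \<odot>\<^bsub>E\<^esub> (l \<odot>\<^bsub>E\<^esub> x) = (k * l) \<odot>\<^bsub>E\<^esub> x"
  using smult_assoc1 by simp

lemma smult_add_right: "k \<in> K \<Longrightarrow> x \<in> carrier E \<Longrightarrow> y \<in> carrier E \<Longrightarrow>
    k \<odot>\<^bsub>E\<^esub> (x \<oplus>\<^bsub>E\<^esub> y) = k \<odot>\<^bsub>E\<^esub> x \<oplus>\<^bsub>E\<^esub> k \<odot>\<^bsub>E\<^esub> y"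
  using smult_r_distr by simp

lemma smult_one' [simp]: "x \<in> carrier E \<Longrightarrow> 1 \<odot>\<^bsub>E\<^esub> x = x"
  using smult_one by simp

lemma smult_zero' [simp]: "x \<in> carrier E \<Longrightarrow> 0 \<odot>\<^bsub>E\<^esub> x = \<zero>\<^bsub>E\<^esub>"
  using smult_l_null by simp

lemma norm_zero [simp]: "nrm E \<zero>\<^bsub>E\<^esub> = 0"
  using norm_eq_0 by simp

lemma smult_minus_one:
  assumes "x \<in> carrier E"
  shows "(- 1) \<odot>\<^bsub>E\<^esub> x = \<ominus>\<^bsub>E\<^esub> x"
proof -
  have "(- 1) \<odot>\<^bsub>E\<^esub> x \<oplus>\<^bsub>E\<^esub> x = \<zero>\<^bsub>E\<^esub>"
    using smult_add_left[of "-1" 1 x] assms by simp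
  then show ?thesis
    using assms by (metis M.minus_equality smult_in scalar_simps(3))
qed

lemma norm_uminus: "x \<in> carrier E \<Longrightarrow> nrm E (\<ominus>\<^bsub>E\<^esub> x) = nrm E x"
  using norm_smult[of "-1" x] by (simp add: smult_minus_one)

lemma norm_minus_commute:
  assumes "x \<in> carrier E" "y \<in> carrier E"
  shows "nrm E (x \<ominus>\<^bsub>E\<^esub> y) = nrm E (y \<ominus>\<^bsub>E\<^esub> x)"
proof -
  have "x \<ominus>\<^bsub>E\<^esub> y = \<ominus>\<^bsub>E\<^esub> (y \<ominus>\<^bsub>E\<^esub> x)"
    using assms by (simp add: M.minus_eq M.minus_add M.a_comm)
  then show ?thesis
    using assms norm_uminus[of "y \<ominus>\<^bsub>E\<^esub> x"] by simp
qed

lemma minus_eq_zero_iff: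
  assumes "x \<in> carrier E" "y \<in> carrier E"
  shows "x \<ominus>\<^bsub>E\<^esub> y = \<zero>\<^bsub>E\<^esub> \<longleftrightarrow> x = y"
proof
  assume "x \<ominus>\<^bsub>E\<^esub> y = \<zero>\<^bsub>E\<^esub>"
  then have "\<ominus>\<^bsub>E\<^esub> (\<ominus>\<^bsub>E\<^esub> y) = x"
    using assms by (intro M.minus_equality) (simp_all add: M.minus_eq)
  then show "x = y"
    using assms by simp
qed (use assms in \<open>simp add: M.minus_eq M.r_neg\<close>)

lemma Metric_space_ndist: "Metric_space (carrier E) (ndist E)"
proof
  fix x y
  show "0 \<le> ndist E x y" "ndist E x y = ndist E y x"
    using norm_nonneg norm_minus_commute by (auto simp: ndist_def)
next
  fix x y assume "x \<in> carrier E" "y \<in> carrier E"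
  then show "ndist E x y = 0 \<longleftrightarrow> x = y"
    using norm_eq_0[of "x \<ominus>\<^bsub>E\<^esub> y"] 
    by (auto simp: ndist_def minus_eq_zero_iff)
next
  fix x y z assume *: "x \<in> carrier E" "y \<in> carrier E" "z \<in> carrier E"
  have "x \<ominus>\<^bsub>E\<^esub> z = (x \<ominus>\<^bsub>E\<^esub> y) \<oplus>\<^bsub>E\<^esub> (y \<ominus>\<^bsub>E\<^esub> z)"
    using * by (simp add: M.minus_eq M.a_assoc M.r_neg1 M.r_neg2)
  then show "ndist E x z \<le> ndist E x y + ndist E y z"
    using * norm_triangle[of "x \<ominus>\<^bsub>E\<^esub> y" "y \<ominus>\<^bsub>E\<^esub> z"] by (simp add: ndist_def)
qed

lemma mcomplete_iff:
  "Metric_space.mcomplete (carrier E) (ndist E) \<longleftrightarrow>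
    (\<forall>s. (\<forall>n::nat. s n \<in> carrier E) \<and>
         (\<forall>\<epsilon>>0. \<exists>N. \<forall>m\<ge>N. \<forall>n\<ge>N. nrm E (s m \<ominus>\<^bsub>E\<^esub> s n) < \<epsilon>)
      \<longrightarrow> (\<exists>x\<in>carrier E. \<forall>\<epsilon>>0. \<exists>N. \<forall>n\<ge>N. nrm E (s n \<ominus>\<^bsub>E\<^esub> x) < \<epsilon>))"
proof -
  interpret Metric_space "carrier E" "ndist E" by (rule Metric_space_ndist)
  have 1: "MCauchy s \<longleftrightarrow> (\<forall>n. s n \<in> carrier E) \<and>
         (\<forall>\<epsilon>>0. \<exists>N. \<forall>m\<ge>N. \<forall>n\<ge>N. nrm E (s m \<ominus>\<^bsub>E\<^esub> s n) < \<epsilon>)" for s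
    unfolding MCauchy_def image_subset_iff
    by (intro conj_cong) (auto simp: ndist_def)
  have 2: "limitin mtopology s x sequentially \<longleftrightarrow>
      x \<in> carrier E \<and> (\<forall>\<epsilon>>0. \<exists>N. \<forall>n\<ge>N. nrm E (s n \<ominus>\<^bsub>E\<^esub> x) < \<epsilon>)"
    if "\<forall>n. s n \<in> carrier E" for s x
    unfolding limitin_metric eventually_sequentially
    using that by (auto simp: ndist_def)
  show ?thesis
    unfolding mcomplete_def 1 using 2 by (metis (no_types, lifting))
qed

end

lemma normed_space_banachI:
  assumes "normed_space K E"
    and "\<And>s::nat \<Rightarrow> _. \<lbrakk>\<And>n. s n \<in> carrier E;
           \<And>\<epsilon>. \<epsilon> > 0 \<Longrightarrow> \<exists>N. \<forall>m\<ge>N. \<forall>n\<ge>N. nrm E (s m \<ominus>\<^bsub>E\<^esub> s n) < \<epsilon>\<rbrakk>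
      \<Longrightarrow> \<exists>x\<in>carrier E. \<forall>\<epsilon>>0. \<exists>N. \<forall>n\<ge>N. nrm E (s n \<ominus>\<^bsub>E\<^esub> x) < \<epsilon>"
  shows "banach_space K E"
proof -
  interpret normed_space K E by fact
  show ?thesis
    by unfold_locales
      (use norm_nonneg norm_eq_0 norm_triangle norm_smult mcomplete_iff assms(2) in \<open>auto\<close>)
qed

text \<open>The bimodules over which \<open>amenable\<close> quantifies have their carriers in one fixed type. Other
  bimodules are reached through copies in that type, and completeness must pass to the copy.\<close>

lemma banach_space_isometric_copy:
  assumes K: "K = \<real> \<or> K = UNIV" and E: "banach_space K E"
    and j: "bij_betw j (carrier E) (carrier F)"
    and zero: "\<zero>\<^bsub>F\<^esub> = j \<zero>\<^bsub>E\<^esub>"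
    and add: "\<And>x y. x \<in> carrier E \<Longrightarrow> y \<in> carrier E \<Longrightarrow> j (x \<oplus>\<^bsub>E\<^esub> y) = j x \<oplus>\<^bsub>F\<^esub> j y"
    and smult: "\<And>k x. k \<in> K \<Longrightarrow> x \<in> carrier E \<Longrightarrow> j (k \<odot>\<^bsub>E\<^esub> x) = k \<odot>\<^bsub>F\<^esub> j x"
    and nrm: "\<And>x. x \<in> carrier E \<Longrightarrow> nrm F (j x) = nrm E x"
  shows "banach_space K F"
proof -
  interpret E: normed_space K E by (rule banach_normed_space) fact+
  have F: "carrier F = j ` carrier E" and inj: "inj_on j (carrier E)"
    using j by (auto simp: bij_betw_def)
  have ab: "abelian_group F"
  proof (rule abelian_groupI)
    fix u v w assume "u \<in> carrier F" "v \<in> carrier F" "w \<in> carrier F"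
    then obtain x y z where *: "x \<in> carrier E" "y \<in> carrier E" "z \<in> carrier E"
        "u = j x" "v = j y" "w = j z"
      by (auto simp: F)
    then show "u \<oplus>\<^bsub>F\<^esub> v \<in> carrier F" "u \<oplus>\<^bsub>F\<^esub> v = v \<oplus>\<^bsub>F\<^esub> u"
        "u \<oplus>\<^bsub>F\<^esub> v \<oplus>\<^bsub>F\<^esub> w = u \<oplus>\<^bsub>F\<^esub> (v \<oplus>\<^bsub>F\<^esub> w)"
      by (auto simp: F add[symmetric] E.M.a_ac)
  next
    fix u assume "u \<in> carrier F"
    then obtain x where x: "x \<in> carrier E" "u = j x" by (auto simp: F)
    then show "\<zero>\<^bsub>F\<^esub> \<oplus>\<^bsub>F\<^esub> u = u"
      by (simp add: zero add[symmetric])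
    show "\<exists>v\<in>carrier F. v \<oplus>\<^bsub>F\<^esub> u = \<zero>\<^bsub>F\<^esub>"
      using x by (intro bexI[of _ "j (\<ominus>\<^bsub>E\<^esub> x)"]) (auto simp: F zero add[symmetric] E.M.l_neg)
  qed (auto simp: F zero)
  have mod: "Module.module (scalars K) F"
  proof (rule moduleI[OF cring_scalars[OF K] ab])
    fix u v k l assume "u \<in> carrier F" "v \<in> carrier F" and kl: "k \<in> carrier (scalars K)" "l \<in> carrier (scalars K)"
    then obtain x y where *: "x \<in> carrier E" "y \<in> carrier E" "u = j x" "v = j y"
      by (auto simp: F)
    show "k \<odot>\<^bsub>F\<^esub> u \<in> carrier F" "k \<odot>\<^bsub>F\<^esub> (u \<oplus>\<^bsub>F\<^esub> v) = k \<odot>\<^bsub>F\<^esub> u \<oplus>\<^bsub>F\<^esub> k \<odot>\<^bsub>F\<^esub> v"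
        "(k \<oplus>\<^bsub>scalars K\<^esub> l) \<odot>\<^bsub>F\<^esub> u = k \<odot>\<^bsub>F\<^esub> u \<oplus>\<^bsub>F\<^esub> l \<odot>\<^bsub>F\<^esub> u"
        "(k \<otimes>\<^bsub>scalars K\<^esub> l) \<odot>\<^bsub>F\<^esub> u = k \<odot>\<^bsub>F\<^esub> (l \<odot>\<^bsub>F\<^esub> u)"
      using * kl
      by (auto simp: F add[symmetric] smult[symmetric] E.smult_add_left E.smult_add_right E.smult_smult)
  next
    fix u assume "u \<in> carrier F"
    then show "\<one>\<^bsub>scalars K\<^esub> \<odot>\<^bsub>F\<^esub> u = u"
      using E.real_or_complex by (auto simp: F smult[symmetric])
  qed
  interpret F: normed_space K F
  proof (intro normed_space.intro mod normed_space_axioms.intro K)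
    fix u v assume "u \<in> carrier F" "v \<in> carrier F"
    then show "nrm F (u \<oplus>\<^bsub>F\<^esub> v) \<le> nrm F u + nrm F v"
      using E.norm_triangle by (auto simp: F add[symmetric] nrm)
  next
    fix u k assume "k \<in> K" "u \<in> carrier F"
    then show "nrm F (k \<odot>\<^bsub>F\<^esub> u) = cmod k * nrm F u"
      using E.norm_smult by (auto simp: F smult[symmetric] nrm)
  next
    fix u assume "u \<in> carrier F"
    then obtain x where x: "x \<in> carrier E" "u = j x" by (auto simp: F)
    then show "0 \<le> nrm F u" "nrm F u = 0 \<longleftrightarrow> u = \<zero>\<^bsub>F\<^esub>"
      using E.norm_nonneg E.norm_eq_0 inj by (auto simp: nrm zero inj_on_eq_iff)
  qed
  have minus: "j (x \<ominus>\<^bsub>E\<^esub> y) = j x \<ominus>\<^bsub>F\<^esub> j y" if "x \<in> carrier E" "y \<in> carrier E" for x y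
    by (rule additive_minus[OF E.M.abelian_group_axioms ab]) (use add that in \<open>auto simp: F\<close>)
  show ?thesis
  proof (rule normed_space_banachI[OF F.normed_space_axioms])
    fix s :: "nat \<Rightarrow> 'c"
    assume s: "\<And>n. s n \<in> carrier F"
      and Cauchy: "\<And>\<epsilon>. \<epsilon> > 0 \<Longrightarrow> \<exists>N. \<forall>m\<ge>N. \<forall>n\<ge>N. nrm F (s m \<ominus>\<^bsub>F\<^esub> s n) < \<epsilon>"
    have "\<forall>n. \<exists>x. x \<in> carrier E \<and> s n = j x"
      using s by (auto simp: F)
    then obtain r where r: "\<And>n. r n \<in> carrier E" "\<And>n. s n = j (r n)"
      by metis
    have eq: "nrm F (s n \<ominus>\<^bsub>F\<^esub> j x) = nrm E (r n \<ominus>\<^bsub>E\<^esub> x)" if "x \<in> carrier E" for n x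
      using r that by (simp add: minus[symmetric] nrm)
    have "nrm F (s m \<ominus>\<^bsub>F\<^esub> s n) = nrm E (r m \<ominus>\<^bsub>E\<^esub> r n)" for m n
      by (simp only: r(2)[of n] eq[OF r(1)])
    then have "(\<forall>n. r n \<in> carrier E) \<and>
        (\<forall>\<epsilon>>0. \<exists>N. \<forall>m\<ge>N. \<forall>n\<ge>N. nrm E (r m \<ominus>\<^bsub>E\<^esub> r n) < \<epsilon>)"
      using Cauchy r(1) by simp
    then have "\<exists>x\<in>carrier E. \<forall>\<epsilon>>0. \<exists>N. \<forall>n\<ge>N. nrm E (r n \<ominus>\<^bsub>E\<^esub> x) < \<epsilon>"
      by (rule banach_space.complete[OF E, unfolded E.mcomplete_iff, THEN spec, of r, THEN mp])
    then obtain x where "x \<in> carrier E" "\<forall>\<epsilon>>0. \<exists>N. \<forall>n\<ge>N. nrm E (r n \<ominus>\<^bsub>E\<^esub> x) < \<epsilon>"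
      by blast
    then show "\<exists>x\<in>carrier F. \<forall>\<epsilon>>0. \<exists>N. \<forall>n\<ge>N. nrm F (s n \<ominus>\<^bsub>F\<^esub> x) < \<epsilon>"
      by (intro bexI[of _ "j x"]) (auto simp: eq F)
  qed
qed

section \<open>Dual spaces and dual bimodules\<close>

locale dual_space = normed_space K E
  for K :: "complex set" and E :: "('a, 'a, 'e, 'p) bimod_scheme" (structure)
begin

abbreviation dual :: "('a, 'a, 'e \<Rightarrow> complex) bimod" where
  "dual \<equiv> dual_bimod K E"

lemma dual_iff:
  "f \<in> carrier dual \<longleftrightarrow> f \<in> extensional (carrier E) \<and> (\<forall>x\<in>carrier E. f x \<in> K) \<and>
     (\<forall>x\<in>carrier E. \<forall>y\<in>carrier E. f (x \<oplus>\<^bsub>E\<^esub> y) = f x + f y) \<and>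
     (\<forall>k\<in>K. \<forall>x\<in>carrier E. f (k \<odot>\<^bsub>E\<^esub> x) = k * f x) \<and>
     (\<exists>C. \<forall>x\<in>carrier E. cmod (f x) \<le> C * nrm E x)"
  by (auto simp: dual_bimod_def bounded_linear_map_def)

lemma dual_memI:
  assumes "f \<in> extensional (carrier E)" "\<And>x. x \<in> carrier E \<Longrightarrow> f x \<in> K"
    and "\<And>x y. x \<in> carrier E \<Longrightarrow> y \<in> carrier E \<Longrightarrow> f (x \<oplus>\<^bsub>E\<^esub> y) = f x + f y"
    and "\<And>k x. k \<in> K \<Longrightarrow> x \<in> carrier E \<Longrightarrow> f (k \<odot>\<^bsub>E\<^esub> x) = k * f x"
    and "\<And>x. x \<in> carrier E \<Longrightarrow> cmod (f x) \<le> C * nrm E x"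
  shows "f \<in> carrier dual"
  using assms unfolding dual_iff by blast

lemma
  assumes "f \<in> carrier dual"
  shows dual_in_K [simp]: "x \<in> carrier E \<Longrightarrow> f x \<in> K"
    and dual_add: "x \<in> carrier E \<Longrightarrow> y \<in> carrier E \<Longrightarrow> f (x \<oplus>\<^bsub>E\<^esub> y) = f x + f y"
    and dual_smult: "k \<in> K \<Longrightarrow> x \<in> carrier E \<Longrightarrow> f (k \<odot>\<^bsub>E\<^esub> x) = k * f x"
    and dual_extensional: "f \<in> extensional (carrier E)"
  using assms unfolding dual_iff by blast+

lemma dual_zero: "f \<in> carrier dual \<Longrightarrow> f \<zero>\<^bsub>E\<^esub> = 0"
  using dual_smult[of f 0 "\<zero>\<^bsub>E\<^esub>"] by simp

lemma dual_eqI: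
  assumes "f \<in> carrier dual" "g \<in> carrier dual" "\<And>x. x \<in> carrier E \<Longrightarrow> f x = g x"
  shows "f = g"
  using assms dual_extensional extensionalityI by metis

lemma dual_ops [simp]:
  "zero dual = (\<lambda>x\<in>carrier E. 0)"
  "add dual = (\<lambda>f g. \<lambda>x\<in>carrier E. f x + g x)"
  "smult dual = (\<lambda>k f. \<lambda>x\<in>carrier E. k * f x)"
  "lact dual = (\<lambda>a f. \<lambda>x\<in>carrier E. f (ract E x a))"
  "ract dual = (\<lambda>f a. \<lambda>x\<in>carrier E. f (lact E a x))"
  by (simp_all add: dual_bimod_def)

lemma nrm_dual: "nrm dual f = (SUP x\<in>{x \<in> carrier E. nrm E x \<le> 1}. cmod (f x))"
  by (simp add: dual_bimod_def)

lemma dual_norm_le: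
  assumes "0 \<le> c" "\<And>x. x \<in> carrier E \<Longrightarrow> cmod (f x) \<le> c * nrm E x"
  shows "nrm dual f \<le> c"
  unfolding nrm_dual
proof (rule cSUP_least)
  show "{x \<in> carrier E. nrm E x \<le> 1} \<noteq> {}"
    using norm_zero M.zero_closed by fastforce
  fix x assume "x \<in> {x \<in> carrier E. nrm E x \<le> 1}"
  then show "cmod (f x) \<le> c"
    using assms(2)[of x] mult_left_le[of "nrm E x" c] assms(1) by auto
qed

lemma bdd_above_dual:
  assumes "f \<in> carrier dual"
  shows "bdd_above ((\<lambda>x. cmod (f x)) ` {x \<in> carrier E. nrm E x \<le> 1})"
proof -
  obtain C where C: "\<And>x. x \<in> carrier E \<Longrightarrow> cmod (f x) \<le> C * nrm E x"
    using assms unfolding dual_iff by blast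
  have "cmod (f x) \<le> \<bar>C\<bar>" if "x \<in> carrier E" "nrm E x \<le> 1" for x
  proof -
    have "C * nrm E x \<le> \<bar>C\<bar> * nrm E x"
      using norm_nonneg[of x] that by (intro mult_right_mono) auto
    also have "\<dots> \<le> \<bar>C\<bar>"
      using mult_left_le[of "nrm E x" "\<bar>C\<bar>"] that by simp
    finally show ?thesis using C[of x] that by simp
  qed
  then show ?thesis
    by (auto simp: bdd_above_def)
qed

text \<open>The norm of the dual is a supremum over the unit ball, onto which a nonzero vector is moved by
  a real scalar.\<close>

lemma dual_norm_bound:
  assumes f: "f \<in> carrier dual" and x: "x \<in> carrier E"
  shows "cmod (f x) \<le> nrm dual f * nrm E x"
proof (cases "nrm E x = 0")
  case True
  then have "x = \<zero>\<^bsub>E\<^esub>"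
    using x norm_eq_0 by simp
  then show ?thesis
    using True dual_zero[OF f] by simp
next
  case False
  then have pos: "nrm E x > 0"
    using norm_nonneg[OF x] by simp
  define u where "u = complex_of_real (1 / nrm E x) \<odot>\<^bsub>E\<^esub> x"
  have u: "u \<in> carrier E" "nrm E u = 1"
    using x pos norm_smult[of "complex_of_real (1 / nrm E x)" x]
    by (simp_all add: u_def norm_divide del: of_real_divide)
  have "cmod (f x) / nrm E x = cmod (f u)"
    using dual_smult[OF f of_real_scalar x] pos
    by (simp add: u_def norm_mult norm_divide del: of_real_divide)
  also have "\<dots> \<le> nrm dual f"
    unfolding nrm_dual using u by (intro cSUP_upper bdd_above_dual[OF f]) auto
  finally show ?thesis
    using pos by (simp add: divide_le_eq)
qed

lemma dual_norm_nonneg: "f \<in> carrier dual \<Longrightarrow> 0 \<le> nrm dual f"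
  unfolding nrm_dual
  using bdd_above_dual[of f] norm_zero dual_zero[of f]
  by (intro cSUP_upper2[of _ _ "\<zero>\<^bsub>E\<^esub>"]) auto

lemma dual_add_closed:
  assumes "f \<in> carrier dual" "g \<in> carrier dual"
  shows "f \<oplus>\<^bsub>dual\<^esub> g \<in> carrier dual"
proof (rule dual_memI[where C = "nrm dual f + nrm dual g"])
  fix x assume "x \<in> carrier E"
  then show "cmod ((f \<oplus>\<^bsub>dual\<^esub> g) x) \<le> (nrm dual f + nrm dual g) * nrm E x"
    using dual_norm_bound[OF assms(1), of x] dual_norm_bound[OF assms(2), of x]
      norm_triangle_ineq[of "f x" "g x"] by (simp add: algebra_simps)
qed (use assms in \<open>auto simp: dual_add dual_smult algebra_simps\<close>)

lemma dual_smult_closed: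
  assumes "f \<in> carrier dual" "k \<in> K"
  shows "k \<odot>\<^bsub>dual\<^esub> f \<in> carrier dual"
proof (rule dual_memI[where C = "cmod k * nrm dual f"])
  fix x assume "x \<in> carrier E"
  then show "cmod ((k \<odot>\<^bsub>dual\<^esub> f) x) \<le> (cmod k * nrm dual f) * nrm E x"
    using mult_left_mono[OF dual_norm_bound[OF assms(1), of x], of "cmod k"]
    by (simp add: norm_mult mult.assoc)
qed (use assms in \<open>auto simp: dual_add dual_smult algebra_simps\<close>)

lemma dual_zero_closed: "\<zero>\<^bsub>dual\<^esub> \<in> carrier dual"
  by (rule dual_memI[where C = 0]) auto

lemma dual_abelian_group: "abelian_group dual"
proof (rule abelian_groupI)
  fix f assume f: "f \<in> carrier dual"
  show "\<exists>g\<in>carrier dual. g \<oplus>\<^bsub>dual\<^esub> f = \<zero>\<^bsub>dual\<^esub>"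
    by (rule bexI[OF _ dual_smult_closed[OF f, of "-1"]]) auto
  show "\<zero>\<^bsub>dual\<^esub> \<oplus>\<^bsub>dual\<^esub> f = f"
    using dual_add_closed[OF dual_zero_closed f] f by (rule dual_eqI) simp
qed (use dual_add_closed dual_zero_closed in \<open>auto simp: algebra_simps\<close>)

lemma dual_minus_apply:
  assumes "f \<in> carrier dual" "g \<in> carrier dual" "x \<in> carrier E"
  shows "(f \<ominus>\<^bsub>dual\<^esub> g) x = f x - g x"
proof -
  interpret D: abelian_group dual by (rule dual_abelian_group)
  have "f = (f \<ominus>\<^bsub>dual\<^esub> g) \<oplus>\<^bsub>dual\<^esub> g"
    using assms by (simp add: D.minus_eq D.a_assoc D.l_neg del: dual_ops)
  then have "f x = ((f \<ominus>\<^bsub>dual\<^esub> g) \<oplus>\<^bsub>dual\<^esub> g) x"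
    by (rule arg_cong)
  then show ?thesis
    using assms(3) by simp
qed

lemma dual_normed_space: "normed_space K dual"
proof (intro normed_space.intro normed_space_axioms.intro real_or_complex)
  show "Module.module (scalars K) dual"
  proof (rule moduleI[OF cring_scalars[OF real_or_complex] dual_abelian_group])
    fix f assume f: "f \<in> carrier dual"
    show "\<one>\<^bsub>scalars K\<^esub> \<odot>\<^bsub>dual\<^esub> f = f"
      using dual_smult_closed[OF f, of 1] f by (intro dual_eqI) auto
  qed (use dual_smult_closed in \<open>auto simp: algebra_simps\<close>)
next
  fix f assume f: "f \<in> carrier dual"
  show "0 \<le> nrm dual f"
    by (rule dual_norm_nonneg[OF f])
  have "f = \<zero>\<^bsub>dual\<^esub>" if "nrm dual f = 0"
    using f dual_zero_closed by (rule dual_eqI) (use dual_norm_bound[OF f] that in auto)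
  moreover have "nrm dual \<zero>\<^bsub>dual\<^esub> \<le> 0"
    by (rule dual_norm_le) auto
  ultimately show "nrm dual f = 0 \<longleftrightarrow> f = \<zero>\<^bsub>dual\<^esub>"
    using dual_norm_nonneg[OF dual_zero_closed] by (metis order_antisym)
next
  fix f g assume fg: "f \<in> carrier dual" "g \<in> carrier dual"
  show "nrm dual (f \<oplus>\<^bsub>dual\<^esub> g) \<le> nrm dual f + nrm dual g"
  proof (rule dual_norm_le)
    fix x assume "x \<in> carrier E"
    then show "cmod ((f \<oplus>\<^bsub>dual\<^esub> g) x) \<le> (nrm dual f + nrm dual g) * nrm E x"
      using dual_norm_bound[OF fg(1), of x] dual_norm_bound[OF fg(2), of x]
        norm_triangle_ineq[of "f x" "g x"] by (simp add: algebra_simps)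
  qed (use dual_norm_nonneg fg in auto)
next
  fix k f assume k: "k \<in> K" and f: "f \<in> carrier dual"
  have le: "nrm dual (l \<odot>\<^bsub>dual\<^esub> g) \<le> cmod l * nrm dual g" if "g \<in> carrier dual" for l g
  proof (rule dual_norm_le)
    fix x assume "x \<in> carrier E"
    then show "cmod ((l \<odot>\<^bsub>dual\<^esub> g) x) \<le> cmod l * nrm dual g * nrm E x"
      using mult_left_mono[OF dual_norm_bound[OF that, of x], of "cmod l"]
      by (simp add: norm_mult mult.assoc)
  qed (use dual_norm_nonneg[OF that] in auto)
  show "nrm dual (k \<odot>\<^bsub>dual\<^esub> f) = cmod k * nrm dual f"
  proof (cases "k = 0")
    case True
    then show ?thesis
      using le[OF f, of 0] dual_norm_nonneg[OF dual_smult_closed[OF f k]]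
      by (simp del: dual_ops)
  next
    case False
    have "inverse k \<odot>\<^bsub>dual\<^esub> (k \<odot>\<^bsub>dual\<^esub> f) = f"
      using dual_extensional[OF f] False
      by (auto simp: restrict_def extensional_def fun_eq_iff)
    then have "nrm dual f \<le> inverse (cmod k) * nrm dual (k \<odot>\<^bsub>dual\<^esub> f)"
      using le[OF dual_smult_closed[OF f k], of "inverse k"] by (simp add: norm_inverse del: dual_ops)
    then have "cmod k * nrm dual f \<le> nrm dual (k \<odot>\<^bsub>dual\<^esub> f)"
      using False by (simp add: field_simps del: dual_ops)
    then show ?thesis
      using le[OF f, of k] by simp
  qed
qed

text \<open>A Cauchy sequence of functionals converges pointwise, with limits in the closed set \<open>K\<close>, and
  the estimate \<open>cmod (s m x - s n x) \<le> \<epsilon> * nrm E x\<close>, uniform in \<open>x\<close>, survives letting \<open>m\<close> go to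
  infinity.\<close>

lemma dual_banach_space: "banach_space K dual"
proof (rule normed_space_banachI[OF dual_normed_space])
  interpret D: normed_space K dual by (rule dual_normed_space)
  fix s :: "nat \<Rightarrow> 'e \<Rightarrow> complex"
  assume s: "\<And>n. s n \<in> carrier dual"
    and Cauchy: "\<And>\<epsilon>. \<epsilon> > 0 \<Longrightarrow> \<exists>N. \<forall>m\<ge>N. \<forall>n\<ge>N. nrm dual (s m \<ominus>\<^bsub>dual\<^esub> s n) < \<epsilon>"
  have diff: "cmod (s m x - s n x) \<le> nrm dual (s m \<ominus>\<^bsub>dual\<^esub> s n) * nrm E x"
    if "x \<in> carrier E" for m n x
    using dual_norm_bound[of "s m \<ominus>\<^bsub>dual\<^esub> s n" x] that s D.M.minus_closed
    by (simp add: dual_minus_apply del: dual_ops)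
  have ev: "\<exists>N. \<forall>m\<ge>N. \<forall>n\<ge>N. \<forall>x\<in>carrier E. cmod (s m x - s n x) \<le> \<epsilon> * nrm E x"
    if "\<epsilon> > 0" for \<epsilon>
  proof -
    obtain N where N: "\<And>m n. m \<ge> N \<Longrightarrow> n \<ge> N \<Longrightarrow> nrm dual (s m \<ominus>\<^bsub>dual\<^esub> s n) < \<epsilon>"
      using Cauchy[OF \<open>\<epsilon> > 0\<close>] by blast
    have "cmod (s m x - s n x) \<le> \<epsilon> * nrm E x" if "m \<ge> N" "n \<ge> N" "x \<in> carrier E" for m n x
      using diff[OF that(3), of m n] mult_right_mono[OF less_imp_le[OF N[OF that(1,2)]] norm_nonneg[OF that(3)]]
      by linarith
    then show ?thesis by blast
  qed
  have "Cauchy (\<lambda>n. s n x)" if x: "x \<in> carrier E" for x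
  proof (rule CauchyI)
    fix e :: real assume "e > 0"
    then have "e / (nrm E x + 1) > 0"
      using norm_nonneg[OF x] by simp
    then obtain N where N: "\<And>m n. m \<ge> N \<Longrightarrow> n \<ge> N \<Longrightarrow> cmod (s m x - s n x) \<le> e / (nrm E x + 1) * nrm E x"
      using ev x by blast
    have "e / (nrm E x + 1) * nrm E x < e"
      using norm_nonneg[OF x] \<open>e > 0\<close> by (simp add: field_simps)
    then show "\<exists>M. \<forall>m\<ge>M. \<forall>n\<ge>M. cmod (s m x - s n x) < e"
      using N by (meson le_less_trans)
  qed
  then have "\<forall>x\<in>carrier E. \<exists>l. (\<lambda>n. s n x) \<longlonglongrightarrow> l"
    using Cauchy_convergent convergent_def by blast
  then obtain l where l: "\<And>x. x \<in> carrier E \<Longrightarrow> (\<lambda>n. s n x) \<longlonglongrightarrow> l x"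
    by metis
  define f where "f = restrict l (carrier E)"
  have f: "(\<lambda>n. s n x) \<longlonglongrightarrow> f x" if "x \<in> carrier E" for x
    using l[OF that] that by (simp add: f_def)
  have lim: "\<exists>N. \<forall>n\<ge>N. \<forall>x\<in>carrier E. cmod (s n x - f x) \<le> \<epsilon> * nrm E x" if "\<epsilon> > 0" for \<epsilon>
  proof -
    obtain N where N: "\<And>m n x. m \<ge> N \<Longrightarrow> n \<ge> N \<Longrightarrow> x \<in> carrier E \<Longrightarrow>
        cmod (s n x - s m x) \<le> \<epsilon> * nrm E x"
      using ev[OF \<open>\<epsilon> > 0\<close>] by blast
    have "cmod (s n x - f x) \<le> \<epsilon> * nrm E x" if "n \<ge> N" "x \<in> carrier E" for n x
    proof (rule LIMSEQ_le_const2)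
      show "(\<lambda>m. cmod (s n x - s m x)) \<longlonglongrightarrow> cmod (s n x - f x)"
        by (intro tendsto_intros f that)
      show "\<exists>N. \<forall>m\<ge>N. cmod (s n x - s m x) \<le> \<epsilon> * nrm E x"
        using N that by blast
    qed
    then show ?thesis by blast
  qed
  have "closed K"
    using real_or_complex closed_complex_Reals by auto
  obtain N where N: "\<And>x. x \<in> carrier E \<Longrightarrow> cmod (s N x - f x) \<le> 1 * nrm E x"
    using lim[of 1] by auto
  have fd: "f \<in> carrier dual"
  proof (rule dual_memI[where C = "nrm dual (s N) + 1"])
    fix x assume x: "x \<in> carrier E"
    show "f x \<in> K"
      by (rule closed_sequentially[OF \<open>closed K\<close> _ f[OF x]]) (use s x in auto)
    have "cmod (f x) \<le> cmod (s N x) + cmod (s N x - f x)"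
      using norm_triangle_ineq4[of "s N x" "s N x - f x"] by simp
    then show "cmod (f x) \<le> (nrm dual (s N) + 1) * nrm E x"
      using N[OF x] dual_norm_bound[OF s x, of N] by (simp add: algebra_simps)
  next
    fix x y assume xy: "x \<in> carrier E" "y \<in> carrier E"
    show "f (x \<oplus>\<^bsub>E\<^esub> y) = f x + f y"
    proof (rule LIMSEQ_unique)
      show "(\<lambda>n. s n (x \<oplus>\<^bsub>E\<^esub> y)) \<longlonglongrightarrow> f (x \<oplus>\<^bsub>E\<^esub> y)"
        using xy by (intro f) auto
      show "(\<lambda>n. s n (x \<oplus>\<^bsub>E\<^esub> y)) \<longlonglongrightarrow> f x + f y"
        using tendsto_add[OF f f] xy s by (simp add: dual_add)
    qed
  next
    fix k x assume kx: "k \<in> K" "x \<in> carrier E"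
    show "f (k \<odot>\<^bsub>E\<^esub> x) = k * f x"
    proof (rule LIMSEQ_unique)
      show "(\<lambda>n. s n (k \<odot>\<^bsub>E\<^esub> x)) \<longlonglongrightarrow> f (k \<odot>\<^bsub>E\<^esub> x)"
        using kx by (intro f) auto
      show "(\<lambda>n. s n (k \<odot>\<^bsub>E\<^esub> x)) \<longlonglongrightarrow> k * f x"
        using tendsto_mult_left[OF f] kx s by (simp add: dual_smult)
    qed
  qed (simp add: f_def)
  show "\<exists>f\<in>carrier dual. \<forall>\<epsilon>>0. \<exists>N. \<forall>n\<ge>N. nrm dual (s n \<ominus>\<^bsub>dual\<^esub> f) < \<epsilon>"
  proof (intro bexI[OF _ fd] allI impI)
    fix \<epsilon> :: real assume "\<epsilon> > 0"
    then obtain N where N: "\<And>n x. n \<ge> N \<Longrightarrow> x \<in> carrier E \<Longrightarrow> cmod (s n x - f x) \<le> \<epsilon> / 2 * nrm E x"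
      using lim[of "\<epsilon> / 2"] by auto
    have "nrm dual (s n \<ominus>\<^bsub>dual\<^esub> f) \<le> \<epsilon> / 2" if "n \<ge> N" for n
      by (rule dual_norm_le) (use \<open>\<epsilon> > 0\<close> N that s fd in \<open>auto simp: dual_minus_apply\<close>)
    then show "\<exists>N. \<forall>n\<ge>N. nrm dual (s n \<ominus>\<^bsub>dual\<^esub> f) < \<epsilon>"
      using \<open>\<epsilon> > 0\<close> by (intro exI[of _ N]) fastforce
  qed
qed

end

section \<open>Bimodules and derivations\<close>

lemma bounded_linear_mapD:
  assumes "bounded_linear_map K E F T"
  shows "x \<in> carrier E \<Longrightarrow> T x \<in> carrier F"
    and "x \<in> carrier E \<Longrightarrow> y \<in> carrier E \<Longrightarrow> T (x \<oplus>\<^bsub>E\<^esub> y) = T x \<oplus>\<^bsub>F\<^esub> T y"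
    and "k \<in> K \<Longrightarrow> x \<in> carrier E \<Longrightarrow> T (k \<odot>\<^bsub>E\<^esub> x) = k \<odot>\<^bsub>F\<^esub> T x"
    and "\<exists>C. \<forall>x\<in>carrier E. nrm F (T x) \<le> C * nrm E x"
  using assms unfolding bounded_linear_map_def by blast+

lemma bounded_linear_mapI:
  assumes "\<And>x. x \<in> carrier E \<Longrightarrow> T x \<in> carrier F"
    and "\<And>x y. x \<in> carrier E \<Longrightarrow> y \<in> carrier E \<Longrightarrow> T (x \<oplus>\<^bsub>E\<^esub> y) = T x \<oplus>\<^bsub>F\<^esub> T y"
    and "\<And>k x. k \<in> K \<Longrightarrow> x \<in> carrier E \<Longrightarrow> T (k \<odot>\<^bsub>E\<^esub> x) = k \<odot>\<^bsub>F\<^esub> T x"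
    and "\<And>x. x \<in> carrier E \<Longrightarrow> nrm F (T x) \<le> C * nrm E x"
  shows "bounded_linear_map K E F T"
  using assms unfolding bounded_linear_map_def by blast

lemma bounded_linear_map_compose:
  assumes "bounded_linear_map K E F S" "bounded_linear_map K F G T"
    and nonneg: "\<And>x. x \<in> carrier F \<Longrightarrow> 0 \<le> nrm F x"
  shows "bounded_linear_map K E G (\<lambda>x. T (S x))"
proof -
  note S = bounded_linear_mapD[OF assms(1)] and T = bounded_linear_mapD[OF assms(2)]
  obtain C where C: "\<And>x. x \<in> carrier E \<Longrightarrow> nrm F (S x) \<le> C * nrm E x"
    using S(4) by blast
  obtain C' where C': "\<And>x. x \<in> carrier F \<Longrightarrow> nrm G (T x) \<le> C' * nrm F x"
    using T(4) by blast
  show ?thesis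
  proof (rule bounded_linear_mapI[where C = "\<bar>C'\<bar> * C"])
    fix x assume x: "x \<in> carrier E"
    have "nrm G (T (S x)) \<le> C' * nrm F (S x)"
      using C' S(1) x by simp
    also have "\<dots> \<le> \<bar>C'\<bar> * nrm F (S x)"
      using nonneg S(1) x by (intro mult_right_mono) auto
    also have "\<dots> \<le> \<bar>C'\<bar> * (C * nrm E x)"
      using C x by (intro mult_left_mono) auto
    finally show "nrm G (T (S x)) \<le> \<bar>C'\<bar> * C * nrm E x"
      by (simp add: mult.assoc)
  qed (simp_all add: S(1-3) T(1-3))
qed

lemma bounded_bilinear_mapI:
  assumes "\<And>x y. x \<in> carrier E \<Longrightarrow> y \<in> carrier F \<Longrightarrow> b x y \<in> carrier G"
    and "\<And>x x' y. x \<in> carrier E \<Longrightarrow> x' \<in> carrier E \<Longrightarrow> y \<in> carrier F \<Longrightarrow>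
          b (x \<oplus>\<^bsub>E\<^esub> x') y = b x y \<oplus>\<^bsub>G\<^esub> b x' y"
    and "\<And>x y y'. x \<in> carrier E \<Longrightarrow> y \<in> carrier F \<Longrightarrow> y' \<in> carrier F \<Longrightarrow>
          b x (y \<oplus>\<^bsub>F\<^esub> y') = b x y \<oplus>\<^bsub>G\<^esub> b x y'"
    and "\<And>k x y. k \<in> K \<Longrightarrow> x \<in> carrier E \<Longrightarrow> y \<in> carrier F \<Longrightarrow> b (k \<odot>\<^bsub>E\<^esub> x) y = k \<odot>\<^bsub>G\<^esub> b x y"
    and "\<And>k x y. k \<in> K \<Longrightarrow> x \<in> carrier E \<Longrightarrow> y \<in> carrier F \<Longrightarrow> b x (k \<odot>\<^bsub>F\<^esub> y) = k \<odot>\<^bsub>G\<^esub> b x y"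
    and C: "\<And>x y. x \<in> carrier E \<Longrightarrow> y \<in> carrier F \<Longrightarrow> nrm G (b x y) \<le> C * nrm E x * nrm F y"
  shows "bounded_bilinear_map K E F G b"
  unfolding bounded_bilinear_map_def
proof (intro conjI ballI)
  fix x assume "x \<in> carrier E"
  then show "bounded_linear_map K F G (b x)"
    by (intro bounded_linear_mapI[where C = "C * nrm E x"]) (use assms in auto)
next
  fix y assume y: "y \<in> carrier F"
  have "nrm G (b x y) \<le> C * nrm F y * nrm E x" if "x \<in> carrier E" for x
    using C[OF that y] by (simp add: algebra_simps)
  then show "bounded_linear_map K E G (\<lambda>x. b x y)"
    by (intro bounded_linear_mapI[where C = "C * nrm F y"]) (use assms y in auto)
qed (use C in blast)

lemma bounded_bilinear_mapD:
  assumes "bounded_bilinear_map K E F G b"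
  shows "x \<in> carrier E \<Longrightarrow> y \<in> carrier F \<Longrightarrow> b x y \<in> carrier G"
    and "x \<in> carrier E \<Longrightarrow> x' \<in> carrier E \<Longrightarrow> y \<in> carrier F \<Longrightarrow>
          b (x \<oplus>\<^bsub>E\<^esub> x') y = b x y \<oplus>\<^bsub>G\<^esub> b x' y"
    and "x \<in> carrier E \<Longrightarrow> y \<in> carrier F \<Longrightarrow> y' \<in> carrier F \<Longrightarrow>
          b x (y \<oplus>\<^bsub>F\<^esub> y') = b x y \<oplus>\<^bsub>G\<^esub> b x y'"
    and "k \<in> K \<Longrightarrow> x \<in> carrier E \<Longrightarrow> y \<in> carrier F \<Longrightarrow> b (k \<odot>\<^bsub>E\<^esub> x) y = k \<odot>\<^bsub>G\<^esub> b x y"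
    and "k \<in> K \<Longrightarrow> x \<in> carrier E \<Longrightarrow> y \<in> carrier F \<Longrightarrow> b x (k \<odot>\<^bsub>F\<^esub> y) = k \<odot>\<^bsub>G\<^esub> b x y"
    and "\<exists>C. \<forall>x\<in>carrier E. \<forall>y\<in>carrier F. nrm G (b x y) \<le> C * nrm E x * nrm F y"
  using assms unfolding bounded_bilinear_map_def bounded_linear_map_def by blast+

lemma bounded_bilinear_map_compose:
  assumes S: "bounded_linear_map K E' E S" and T: "bounded_linear_map K F' F T"
    and b: "bounded_bilinear_map K E F G b"
    and nonneg: "\<And>x. x \<in> carrier E \<Longrightarrow> 0 \<le> nrm E x" "\<And>y. y \<in> carrier F \<Longrightarrow> 0 \<le> nrm F y"
  shows "bounded_bilinear_map K E' F' G (\<lambda>x y. b (S x) (T y))"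
proof -
  note S = bounded_linear_mapD[OF S] and T = bounded_linear_mapD[OF T]
    and b = bounded_bilinear_mapD[OF b]
  obtain C1 where C1: "\<And>x. x \<in> carrier E' \<Longrightarrow> nrm E (S x) \<le> C1 * nrm E' x"
    using S(4) by blast
  obtain C2 where C2: "\<And>x. x \<in> carrier F' \<Longrightarrow> nrm F (T x) \<le> C2 * nrm F' x"
    using T(4) by blast
  obtain C where C: "\<And>x y. x \<in> carrier E \<Longrightarrow> y \<in> carrier F \<Longrightarrow> nrm G (b x y) \<le> C * nrm E x * nrm F y"
    using b(6) by blast
  show ?thesis
  proof (rule bounded_bilinear_mapI[where C = "\<bar>C\<bar> * C1 * C2"])
    fix x y assume xy: "x \<in> carrier E'" "y \<in> carrier F'"
    have nn: "0 \<le> nrm E (S x)" "0 \<le> nrm F (T y)"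
      using nonneg S(1) T(1) xy by auto
    have "nrm G (b (S x) (T y)) \<le> C * (nrm E (S x) * nrm F (T y))"
      using C S(1) T(1) xy by (simp add: mult.assoc)
    also have "\<dots> \<le> \<bar>C\<bar> * (nrm E (S x) * nrm F (T y))"
      using nn by (intro mult_right_mono) auto
    also have "\<dots> \<le> \<bar>C\<bar> * ((C1 * nrm E' x) * (C2 * nrm F' y))"
      using nn C1[OF xy(1)] C2[OF xy(2)] by (intro mult_left_mono mult_mono) auto
    finally show "nrm G (b (S x) (T y)) \<le> \<bar>C\<bar> * C1 * C2 * nrm E' x * nrm F' y"
      by (simp add: algebra_simps)
  qed (simp_all add: S(1-3) T(1-3) b(1-5))
qed

locale bimodule =
  fixes K and A :: "('a, 'm) nspace_scheme" and B :: "('b, 'n) nspace_scheme"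
    and X :: "('a, 'b, 'e, 'p) bimod_scheme"
  assumes K: "K = \<real> \<or> K = UNIV"
    and nonneg_left: "a \<in> carrier A \<Longrightarrow> 0 \<le> nrm A a"
    and nonneg_right: "b \<in> carrier B \<Longrightarrow> 0 \<le> nrm B b"
    and bimodule: "banach_bimodule K A B X"
begin

lemma bimodule_banach_space: "banach_space K X"
  and lact_bilinear: "bounded_bilinear_map K A X X (lact X)"
  and ract_bilinear: "bounded_bilinear_map K X B X (ract X)"
  and lact_mult: "a \<in> carrier A \<Longrightarrow> a' \<in> carrier A \<Longrightarrow> x \<in> carrier X \<Longrightarrow>
        lact X (a \<otimes>\<^bsub>A\<^esub> a') x = lact X a (lact X a' x)"
  and ract_mult: "b \<in> carrier B \<Longrightarrow> b' \<in> carrier B \<Longrightarrow> x \<in> carrier X \<Longrightarrow>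
        ract X x (b \<otimes>\<^bsub>B\<^esub> b') = ract X (ract X x b) b'"
  and lact_ract: "a \<in> carrier A \<Longrightarrow> b \<in> carrier B \<Longrightarrow> x \<in> carrier X \<Longrightarrow>
        ract X (lact X a x) b = lact X a (ract X x b)"
  using bimodule unfolding banach_bimodule_def by blast+

sublocale normed_space K X
  by (rule banach_normed_space[OF K bimodule_banach_space])

lemmas lact = bounded_bilinear_mapD[OF lact_bilinear]
lemmas ract = bounded_bilinear_mapD[OF ract_bilinear]

text \<open>Norm estimates of the actions transfer to the dual norm only with a nonnegative constant, which
  can be had because the norms of the two algebras are nonnegative.\<close>

lemma bounds_nonneg:
  "\<exists>C\<ge>0. \<forall>a\<in>carrier A. \<forall>x\<in>carrier X. nrm X (lact X a x) \<le> C * nrm A a * nrm X x"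
  "\<exists>C\<ge>0. \<forall>b\<in>carrier B. \<forall>x\<in>carrier X. nrm X (ract X x b) \<le> C * nrm B b * nrm X x"
proof -
  obtain C where C: "\<And>a x. a \<in> carrier A \<Longrightarrow> x \<in> carrier X \<Longrightarrow> nrm X (lact X a x) \<le> C * nrm A a * nrm X x"
    using lact(6) by blast
  have "nrm X (lact X a x) \<le> \<bar>C\<bar> * nrm A a * nrm X x" if "a \<in> carrier A" "x \<in> carrier X" for a x
  proof -
    have "C * (nrm A a * nrm X x) \<le> \<bar>C\<bar> * (nrm A a * nrm X x)"
      using nonneg_left norm_nonneg that by (intro mult_right_mono) auto
    then show ?thesis using C[OF that] by (simp add: mult.assoc)
  qed
  then show "\<exists>C\<ge>0. \<forall>a\<in>carrier A. \<forall>x\<in>carrier X. nrm X (lact X a x) \<le> C * nrm A a * nrm X x"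
    by (intro exI[of _ "\<bar>C\<bar>"]) auto
  obtain D where D: "\<And>b x. b \<in> carrier B \<Longrightarrow> x \<in> carrier X \<Longrightarrow> nrm X (ract X x b) \<le> D * nrm X x * nrm B b"
    using ract(6) by blast
  have "nrm X (ract X x b) \<le> \<bar>D\<bar> * nrm B b * nrm X x" if "b \<in> carrier B" "x \<in> carrier X" for b x
  proof -
    have "D * (nrm X x * nrm B b) \<le> \<bar>D\<bar> * (nrm X x * nrm B b)"
      using nonneg_right norm_nonneg that by (intro mult_right_mono) auto
    then show ?thesis using D[OF that] by (simp add: algebra_simps)
  qed
  then show "\<exists>C\<ge>0. \<forall>b\<in>carrier B. \<forall>x\<in>carrier X. nrm X (ract X x b) \<le> C * nrm B b * nrm X x"
    by (intro exI[of _ "\<bar>D\<bar>"]) auto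
qed

end

locale dual_bimodule = bimodule K A A E
  for K and A :: "('a, 'm) nspace_scheme" and E :: "('a, 'a, 'e, 'p) bimod_scheme"
begin

sublocale dual_space K E ..

lemma banach_bimodule_dual: "banach_bimodule K A A dual"
proof -
  obtain C1 where "C1 \<ge> 0" and
    C1: "\<And>a x. a \<in> carrier A \<Longrightarrow> x \<in> carrier E \<Longrightarrow> nrm E (lact E a x) \<le> C1 * nrm A a * nrm E x"
    using bounds_nonneg(1) by blast
  obtain C2 where "C2 \<ge> 0" and
    C2: "\<And>a x. a \<in> carrier A \<Longrightarrow> x \<in> carrier E \<Longrightarrow> nrm E (ract E x a) \<le> C2 * nrm A a * nrm E x"
    using bounds_nonneg(2) by blast
  have bound1: "cmod (f (lact E a x)) \<le> C1 * nrm dual f * nrm A a * nrm E x"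
    if "f \<in> carrier dual" "a \<in> carrier A" "x \<in> carrier E" for f a x
  proof -
    have "cmod (f (lact E a x)) \<le> nrm dual f * nrm E (lact E a x)"
      using that by (intro dual_norm_bound lact(1))
    also have "\<dots> \<le> nrm dual f * (C1 * nrm A a * nrm E x)"
      using that by (intro mult_left_mono C1 dual_norm_nonneg)
    finally show ?thesis by (simp add: algebra_simps)
  qed
  have bound2: "cmod (f (ract E x a)) \<le> C2 * nrm A a * nrm dual f * nrm E x"
    if "f \<in> carrier dual" "a \<in> carrier A" "x \<in> carrier E" for f a x
  proof -
    have "cmod (f (ract E x a)) \<le> nrm dual f * nrm E (ract E x a)"
      using that by (intro dual_norm_bound ract(1))
    also have "\<dots> \<le> nrm dual f * (C2 * nrm A a * nrm E x)"
      using that by (intro mult_left_mono C2 dual_norm_nonneg)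
    finally show ?thesis by (simp add: algebra_simps)
  qed
  have closed1: "ract dual f a \<in> carrier dual" if "f \<in> carrier dual" "a \<in> carrier A" for f a
    by (rule dual_memI[where C = "C1 * nrm dual f * nrm A a"])
      (use that lact(1,3,5) bound1 in \<open>auto simp: dual_add dual_smult\<close>)
  have closed2: "lact dual a f \<in> carrier dual" if "f \<in> carrier dual" "a \<in> carrier A" for f a
    by (rule dual_memI[where C = "C2 * nrm A a * nrm dual f"])
      (use that ract(1,2,4) bound2 in \<open>auto simp: dual_add dual_smult\<close>)
  show ?thesis
    unfolding banach_bimodule_def
  proof (intro conjI ballI dual_banach_space)
    show "bounded_bilinear_map K A dual dual (lact dual)"
    proof (rule bounded_bilinear_mapI[where C = C2])
      fix a f assume af: "a \<in> carrier A" "f \<in> carrier dual"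
      show "nrm dual (lact dual a f) \<le> C2 * nrm A a * nrm dual f"
        by (rule dual_norm_le)
          (use af \<open>C2 \<ge> 0\<close> bound2 nonneg_left dual_norm_nonneg in auto)
    qed (use closed2 ract(1-5) in \<open>auto simp: dual_add dual_smult fun_eq_iff\<close>)
    show "bounded_bilinear_map K dual A dual (ract dual)"
    proof (rule bounded_bilinear_mapI[where C = C1])
      fix a f assume af: "a \<in> carrier A" "f \<in> carrier dual"
      show "nrm dual (ract dual f a) \<le> C1 * nrm dual f * nrm A a"
        by (rule dual_norm_le)
          (use af \<open>C1 \<ge> 0\<close> bound1 nonneg_left dual_norm_nonneg in auto)
    qed (use closed1 lact(1-5) in \<open>auto simp: dual_add dual_smult fun_eq_iff\<close>)
  qed (use lact(1) ract(1) lact_mult ract_mult lact_ract in auto)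
qed

end

text \<open>Two changes of a bimodule are made at once, because both concern the same record: the
  carrier is moved along \<open>j\<close> into another type, and the scalars are restricted along \<open>\<phi>\<close> and \<open>\<psi>\<close>.\<close>

definition bimod_along ::
  "('e \<Rightarrow> 'f) \<Rightarrow> ('s \<Rightarrow> 'a) \<Rightarrow> ('t \<Rightarrow> 'b) \<Rightarrow> ('a, 'b, 'e, 'p) bimod_scheme \<Rightarrow> ('s, 't, 'f) bimod" where
  "bimod_along j \<phi> \<psi> X = (let g = inv_into (carrier X) j in
     \<lparr>carrier = j ` carrier X, mult = undefined, one = undefined, zero = j \<zero>\<^bsub>X\<^esub>,
      add = (\<lambda>u v. j (g u \<oplus>\<^bsub>X\<^esub> g v)), smult = (\<lambda>k u. j (k \<odot>\<^bsub>X\<^esub> g u)),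
      nrm = (\<lambda>u. nrm X (g u)),
      lact = (\<lambda>s u. j (lact X (\<phi> s) (g u))), ract = (\<lambda>u t. j (ract X (g u) (\<psi> t)))\<rparr>)"

definition bounded_hom ::
  "complex set \<Rightarrow> ('a, 'm) nspace_scheme \<Rightarrow> ('b, 'n) nspace_scheme \<Rightarrow> ('a \<Rightarrow> 'b) \<Rightarrow> bool" where
  "bounded_hom K S A \<phi> \<longleftrightarrow> bounded_linear_map K S A \<phi> \<and>
     (\<forall>s\<in>carrier S. \<forall>t\<in>carrier S. \<phi> (s \<otimes>\<^bsub>S\<^esub> t) = \<phi> s \<otimes>\<^bsub>A\<^esub> \<phi> t)"

lemma bimod_along_simps:
  "carrier (bimod_along j \<phi> \<psi> X) = j ` carrier X" "zero (bimod_along j \<phi> \<psi> X) = j \<zero>\<^bsub>X\<^esub>"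
  by (simp_all add: bimod_along_def Let_def)

lemma bimod_along_inj:
  assumes "inj_on j (carrier X)" and "x \<in> carrier X"
  shows "smult (bimod_along j \<phi> \<psi> X) k (j x) = j (k \<odot>\<^bsub>X\<^esub> x)"
    "nrm (bimod_along j \<phi> \<psi> X) (j x) = nrm X x"
    "lact (bimod_along j \<phi> \<psi> X) s (j x) = j (lact X (\<phi> s) x)"
    "ract (bimod_along j \<phi> \<psi> X) (j x) t = j (ract X x (\<psi> t))"
    "y \<in> carrier X \<Longrightarrow> add (bimod_along j \<phi> \<psi> X) (j x) (j y) = j (x \<oplus>\<^bsub>X\<^esub> y)"
  using assms by (simp_all add: bimod_along_def Let_def)

lemma (in bimodule) banach_bimodule_along:
  assumes j: "inj_on j (carrier X)" and \<phi>: "bounded_hom K S A \<phi>" and \<psi>: "bounded_hom K T B \<psi>"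
  shows "banach_bimodule K S T (bimod_along j \<phi> \<psi> X)"
proof -
  let ?F = "bimod_along j \<phi> \<psi> X"
  note along = bimod_along_simps bimod_along_inj[OF j]
  have \<phi>m: "\<And>s t. s \<in> carrier S \<Longrightarrow> t \<in> carrier S \<Longrightarrow> \<phi> (s \<otimes>\<^bsub>S\<^esub> t) = \<phi> s \<otimes>\<^bsub>A\<^esub> \<phi> t"
    and \<phi>l: "bounded_linear_map K S A \<phi>"
    and \<psi>m: "\<And>s t. s \<in> carrier T \<Longrightarrow> t \<in> carrier T \<Longrightarrow> \<psi> (s \<otimes>\<^bsub>T\<^esub> t) = \<psi> s \<otimes>\<^bsub>B\<^esub> \<psi> t"
    and \<psi>l: "bounded_linear_map K T B \<psi>"
    using \<phi> \<psi> by (auto simp: bounded_hom_def)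
  have id: "bounded_linear_map K X X (\<lambda>x. x)"
    by (rule bounded_linear_mapI[where C = 1]) auto
  note l = bounded_bilinear_mapD[OF bounded_bilinear_map_compose[OF \<phi>l id lact_bilinear nonneg_left norm_nonneg]]
  note r = bounded_bilinear_mapD[OF bounded_bilinear_map_compose[OF id \<psi>l ract_bilinear norm_nonneg nonneg_right]]
  obtain C1 where C1: "\<And>a x. a \<in> carrier S \<Longrightarrow> x \<in> carrier X \<Longrightarrow> nrm X (lact X (\<phi> a) x) \<le> C1 * nrm S a * nrm X x"
    using l(6) by blast
  obtain C2 where C2: "\<And>a x. a \<in> carrier T \<Longrightarrow> x \<in> carrier X \<Longrightarrow> nrm X (ract X x (\<psi> a)) \<le> C2 * nrm X x * nrm T a"
    using r(6) by blast
  have \<phi>c: "s \<in> carrier S \<Longrightarrow> \<phi> s \<in> carrier A" for s using bounded_linear_mapD(1)[OF \<phi>l] .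
  have \<psi>c: "s \<in> carrier T \<Longrightarrow> \<psi> s \<in> carrier B" for s using bounded_linear_mapD(1)[OF \<psi>l] .
  show ?thesis
    unfolding banach_bimodule_def
  proof (intro conjI)
    show "banach_space K ?F"
      by (rule banach_space_isometric_copy[OF K bimodule_banach_space, of j])
        (use j in \<open>auto simp: along bij_betw_def\<close>)
    show "bounded_bilinear_map K S ?F ?F (lact ?F)"
      by (rule bounded_bilinear_mapI[where C = C1]) (use l(1-5) C1 in \<open>auto simp: along\<close>)
    show "bounded_bilinear_map K ?F T ?F (ract ?F)"
      by (rule bounded_bilinear_mapI[where C = C2]) (use r(1-5) C2 in \<open>auto simp: along\<close>)
  qed (use l(1) r(1) \<phi>c \<psi>c in \<open>auto simp: along \<phi>m \<psi>m lact_mult ract_mult lact_ract\<close>)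
qed

text \<open>Restricting scalars along \<open>\<phi>\<close> makes \<open>E\<close> a \<open>T\<close>-bimodule, for which \<open>t \<mapsto> D (\<phi> t)\<close> is again a
  derivation into the dual. The carrier of \<open>E\<close> is arbitrary, provided that \<open>j\<close> embeds it in the
  type of bimodules admitted in the amenability of \<open>T\<close>: a derivation into the dual is carried over to
  the copy \<open>F\<close>, and an implementing functional is carried back.\<close>

lemma (in dual_bimodule) amenable_derivation:
  fixes T :: "('t, 'n) nspace_scheme"
    and j :: "'e \<Rightarrow> 'u + ('t \<Rightarrow> 't \<Rightarrow> complex)"
  assumes amenable: "amenable TYPE('u) K T" and nonneg: "\<And>t. t \<in> carrier T \<Longrightarrow> 0 \<le> nrm T t"
    and \<phi>: "bounded_hom K T A \<phi>" and D: "bounded_derivation K A dual D"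
    and j: "inj_on j (carrier E)"
  shows "\<exists>y\<in>carrier dual. \<forall>t\<in>carrier T. \<forall>x\<in>carrier E.
           D (\<phi> t) x = y (ract E x (\<phi> t)) - y (lact E (\<phi> t) x)"
proof -
  define F where "F = bimod_along j \<phi> \<phi> E"
  have Fb: "banach_bimodule K T T F"
    unfolding F_def by (rule banach_bimodule_along[OF j \<phi> \<phi>])
  interpret F: dual_bimodule K T F
    by unfold_locales (fact K nonneg Fb)+
  have along: "carrier F = j ` carrier E"
      "\<And>x k. x \<in> carrier E \<Longrightarrow> k \<odot>\<^bsub>F\<^esub> j x = j (k \<odot>\<^bsub>E\<^esub> x)"
      "\<And>x. x \<in> carrier E \<Longrightarrow> nrm F (j x) = nrm E x"
      "\<And>x t. x \<in> carrier E \<Longrightarrow> lact F t (j x) = j (lact E (\<phi> t) x)"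
      "\<And>x t. x \<in> carrier E \<Longrightarrow> ract F (j x) t = j (ract E x (\<phi> t))"
      "\<And>x y. x \<in> carrier E \<Longrightarrow> y \<in> carrier E \<Longrightarrow> j x \<oplus>\<^bsub>F\<^esub> j y = j (x \<oplus>\<^bsub>E\<^esub> y)"
    unfolding F_def by (simp_all add: bimod_along_simps bimod_along_inj[OF j])
  have \<phi>m: "\<And>s t. s \<in> carrier T \<Longrightarrow> t \<in> carrier T \<Longrightarrow> \<phi> (s \<otimes>\<^bsub>T\<^esub> t) = \<phi> s \<otimes>\<^bsub>A\<^esub> \<phi> t"
    and \<phi>l: "bounded_linear_map K T A \<phi>"
    using \<phi> by (auto simp: bounded_hom_def)
  note \<phi>' = bounded_linear_mapD[OF \<phi>l]
  have Dl: "bounded_linear_map K A dual D"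
    and Dm: "\<And>a b. a \<in> carrier A \<Longrightarrow> b \<in> carrier A \<Longrightarrow>
               D (a \<otimes>\<^bsub>A\<^esub> b) = lact dual a (D b) \<oplus>\<^bsub>dual\<^esub> ract dual (D a) b"
    using D by (auto simp: bounded_derivation_def)
  note D' = bounded_linear_mapD[OF Dl]
  note D\<phi> = bounded_linear_mapD[OF bounded_linear_map_compose[OF \<phi>l Dl nonneg_left]]
  \<comment> \<open>\<open>h\<close> is the isometry of the dual of \<open>E\<close> with the dual of its copy.\<close>
  define h where "h = (\<lambda>f :: 'e \<Rightarrow> complex. \<lambda>u\<in>carrier F. f (inv_into (carrier E) j u))"
  have h: "h f (j x) = f x" if "x \<in> carrier E" for f x
    using that j by (simp add: h_def along)
  have h_ext: "h f \<in> extensional (carrier F)" for f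
    by (simp add: h_def)
  have h_dual: "h f \<in> carrier F.dual" if f: "f \<in> carrier dual" for f
    by (rule F.dual_memI[where C = "nrm dual f"])
      (use f dual_norm_bound[OF f] h_ext in \<open>auto simp: along h dual_add dual_smult\<close>)
  have h_norm: "nrm F.dual (h f) \<le> nrm dual f" if f: "f \<in> carrier dual" for f
    by (rule F.dual_norm_le)
      (use dual_norm_nonneg[OF f] dual_norm_bound[OF f] in \<open>auto simp: along h\<close>)
  obtain C where C: "\<And>t. t \<in> carrier T \<Longrightarrow> nrm dual (D (\<phi> t)) \<le> C * nrm T t"
    using D\<phi>(4) by blast
  have "bounded_derivation K T F.dual (\<lambda>t. h (D (\<phi> t)))"
    unfolding bounded_derivation_def
  proof (intro conjI ballI)
    show "bounded_linear_map K T F.dual (\<lambda>t. h (D (\<phi> t)))"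
    proof (rule bounded_linear_mapI[where C = C])
      fix t assume "t \<in> carrier T"
      then show "nrm F.dual (h (D (\<phi> t))) \<le> C * nrm T t"
        using h_norm[OF D\<phi>(1)] C order_trans by blast
    next
      fix s t assume "s \<in> carrier T" "t \<in> carrier T"
      then show "h (D (\<phi> (s \<oplus>\<^bsub>T\<^esub> t))) = h (D (\<phi> s)) \<oplus>\<^bsub>F.dual\<^esub> h (D (\<phi> t))"
        using D\<phi>(2)[of s t] h by (intro extensionalityI[OF h_ext]) (auto simp: along)
    next
      fix k t assume "k \<in> K" "t \<in> carrier T"
      then show "h (D (\<phi> (k \<odot>\<^bsub>T\<^esub> t))) = k \<odot>\<^bsub>F.dual\<^esub> h (D (\<phi> t))"
        using D\<phi>(3)[of k t] h by (intro extensionalityI[OF h_ext]) (auto simp: along)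
    qed (use h_dual D\<phi>(1) in auto)
    fix s t assume "s \<in> carrier T" "t \<in> carrier T"
    then show "h (D (\<phi> (s \<otimes>\<^bsub>T\<^esub> t)))
        = lact F.dual s (h (D (\<phi> t))) \<oplus>\<^bsub>F.dual\<^esub> ract F.dual (h (D (\<phi> s))) t"
      using Dm[of "\<phi> s" "\<phi> t"] \<phi>'(1) lact(1) ract(1)
      by (intro extensionalityI[OF h_ext]) (auto simp: along h \<phi>m)
  qed
  then have "inner_derivation T F.dual (\<lambda>t. h (D (\<phi> t)))"
    using amenable Fb unfolding amenable_def by blast
  then obtain z where z: "z \<in> carrier F.dual"
    and hz: "\<And>t. t \<in> carrier T \<Longrightarrow> h (D (\<phi> t)) = lact F.dual t z \<ominus>\<^bsub>F.dual\<^esub> ract F.dual z t"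
    unfolding inner_derivation_def by blast
  interpret F': bimodule K T T F.dual
    by unfold_locales (fact K nonneg F.banach_bimodule_dual)+
  show ?thesis
  proof (intro bexI ballI)
    let ?y = "\<lambda>x\<in>carrier E. z (j x)"
    have "cmod (z (j x)) \<le> nrm F.dual z * nrm E x" if "x \<in> carrier E" for x
      using F.dual_norm_bound[OF z, of "j x"] that by (simp add: along)
    then show "?y \<in> carrier dual"
      by (intro dual_memI[where C = "nrm F.dual z"])
        (use z F.dual_add[OF z] F.dual_smult[OF z] in \<open>auto simp: along simp flip: along(2,6)\<close>)
    fix t x assume tx: "t \<in> carrier T" "x \<in> carrier E"
    have "D (\<phi> t) x = (lact F.dual t z \<ominus>\<^bsub>F.dual\<^esub> ract F.dual z t) (j x)"
      using hz[OF tx(1)] h[OF tx(2), of "D (\<phi> t)"] by simp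
    also have "\<dots> = lact F.dual t z (j x) - ract F.dual z t (j x)"
      by (rule F.dual_minus_apply) (use tx z F'.lact(1) F'.ract(1) in \<open>auto simp: along\<close>)
    also have "\<dots> = ?y (ract E x (\<phi> t)) - ?y (lact E (\<phi> t) x)"
      using tx \<phi>'(1) lact(1) ract(1) by (simp add: along)
    finally show "D (\<phi> t) x = ?y (ract E x (\<phi> t)) - ?y (lact E (\<phi> t) x)" .
  qed
qed

text \<open>The canonical map \<open>\<iota>\<close> into the bidual is a bimodule map, so \<open>a \<mapsto> \<iota> (d a)\<close> is a derivation into
  the dual of the bimodule \<open>E\<^sup>*\<close> and hence inner, say \<open>\<iota> (d a) = a \<Phi> - \<Phi> a\<close>. At an element \<open>t\<close> that
  annihilates \<open>E\<close> from both sides, and therefore annihilates its duals, the right-hand side is zero.\<close>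

lemma (in dual_bimodule) amenable_derivation_vanishes:
  fixes j :: "('e \<Rightarrow> complex) \<Rightarrow> 'u + ('a \<Rightarrow> 'a \<Rightarrow> complex)"
  assumes amenable: "amenable TYPE('u) K A" and d: "bounded_derivation K A E d"
    and j: "inj_on j (carrier dual)" and t: "t \<in> carrier A"
    and null: "\<And>x. x \<in> carrier E \<Longrightarrow> lact E t x = \<zero>\<^bsub>E\<^esub>" "\<And>x. x \<in> carrier E \<Longrightarrow> ract E x t = \<zero>\<^bsub>E\<^esub>"
    and f: "f \<in> carrier dual"
  shows "f (d t) = 0"
proof -
  interpret D: dual_bimodule K A dual
    by unfold_locales (fact K nonneg_left banach_bimodule_dual)+
  have dl: "bounded_linear_map K A E d"
    and dm: "\<And>a b. a \<in> carrier A \<Longrightarrow> b \<in> carrier A \<Longrightarrow>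
               d (a \<otimes>\<^bsub>A\<^esub> b) = lact E a (d b) \<oplus>\<^bsub>E\<^esub> ract E (d a) b"
    using d by (auto simp: bounded_derivation_def)
  note d' = bounded_linear_mapD[OF dl]
  obtain C where C: "\<And>a. a \<in> carrier A \<Longrightarrow> nrm E (d a) \<le> C * nrm A a"
    using d'(4) by blast
  define \<iota> where "\<iota> = (\<lambda>x. \<lambda>f\<in>carrier dual. f x)"
  have \<iota>_bound: "cmod (\<iota> x f) \<le> nrm E x * nrm dual f" if "x \<in> carrier E" "f \<in> carrier dual" for x f
    using dual_norm_bound[OF that(2,1)] that by (simp add: \<iota>_def mult.commute)
  have \<iota>: "\<iota> x \<in> carrier D.dual" if "x \<in> carrier E" for x
    by (rule D.dual_memI[where C = "nrm E x"])
      (use that dual_add_closed dual_smult_closed \<iota>_bound[OF that] in \<open>auto simp: \<iota>_def\<close>)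
  have "bounded_derivation K A D.dual (\<lambda>a. \<iota> (d a))"
    unfolding bounded_derivation_def
  proof (intro conjI ballI)
    show "bounded_linear_map K A D.dual (\<lambda>a. \<iota> (d a))"
    proof (rule bounded_linear_mapI[where C = C])
      fix a assume a: "a \<in> carrier A"
      have "nrm D.dual (\<iota> (d a)) \<le> nrm E (d a)"
        by (rule D.dual_norm_le) (use a d'(1) \<iota>_bound norm_nonneg in auto)
      then show "nrm D.dual (\<iota> (d a)) \<le> C * nrm A a"
        using C[OF a] by simp
    qed (use \<iota> d' dual_add dual_smult in \<open>auto simp: \<iota>_def fun_eq_iff\<close>)
    fix a b assume "a \<in> carrier A" "b \<in> carrier A"
    then show "\<iota> (d (a \<otimes>\<^bsub>A\<^esub> b)) = lact D.dual a (\<iota> (d b)) \<oplus>\<^bsub>D.dual\<^esub> ract D.dual (\<iota> (d a)) b"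
      using D.lact(1) D.ract(1) d'(1) lact(1) ract(1)
      by (auto simp: \<iota>_def fun_eq_iff dm dual_add)
  qed
  moreover have "bounded_hom K A A (\<lambda>a. a)"
    unfolding bounded_hom_def by (auto intro: bounded_linear_mapI[where C = 1])
  ultimately obtain \<Phi> where \<Phi>: "\<Phi> \<in> carrier D.dual"
    and eq: "\<And>a g. a \<in> carrier A \<Longrightarrow> g \<in> carrier dual \<Longrightarrow>
               \<iota> (d a) g = \<Phi> (ract dual g a) - \<Phi> (lact dual a g)"
    using D.amenable_derivation[OF amenable nonneg_left _ _ j, of "\<lambda>a. a" "\<lambda>a. \<iota> (d a)"] by blast
  have "ract dual f t = \<zero>\<^bsub>dual\<^esub>" "lact dual t f = \<zero>\<^bsub>dual\<^esub>"
    using null dual_zero[OF f] by (auto simp: fun_eq_iff)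
  then have "\<iota> (d t) f = 0"
    using eq[OF t f] by (simp del: dual_ops)
  then show ?thesis
    using f by (simp add: \<iota>_def)
qed

text \<open>A surjection \<open>\<pi>\<close> defined on the whole type, and not merely onto the carrier, embeds
  \<open>'a \<Rightarrow> 'a \<Rightarrow> complex\<close> in \<open>'t \<Rightarrow> 't \<Rightarrow> complex\<close> by composition. Hence every bimodule admitted in the
  amenability of \<open>A\<close> has a copy among those admitted for \<open>T\<close>.\<close>

lemma amenable_image:
  fixes T :: "('t, 'n) nspace_scheme" and A :: "('a, 'm) nspace_scheme"
  assumes K: "K = \<real> \<or> K = UNIV" and amenable: "amenable TYPE('u) K T"
    and nonneg: "\<And>t. t \<in> carrier T \<Longrightarrow> 0 \<le> nrm T t" "\<And>a. a \<in> carrier A \<Longrightarrow> 0 \<le> nrm A a"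
    and \<pi>: "bounded_hom K T A \<pi>" and onto: "carrier A \<subseteq> \<pi> ` carrier T" and surj: "surj \<pi>"
  shows "amenable TYPE('u) K A"
  unfolding amenable_def
proof (intro allI impI, elim conjE)
  fix E :: "('a, 'a, 'u + ('a \<Rightarrow> 'a \<Rightarrow> complex)) bimod" and D
  assume E: "banach_bimodule K A A E" and D: "bounded_derivation K A (dual_bimod K E) D"
  interpret dual_bimodule K A E
    by unfold_locales (fact K nonneg E)+
  interpret D: bimodule K A A dual
    by unfold_locales (fact K nonneg banach_bimodule_dual)+
  have DA: "D a \<in> carrier dual" if "a \<in> carrier A" for a
    using D that unfolding bounded_derivation_def bounded_linear_map_def by blast
  have "inj (\<lambda>f s t. f (\<pi> s) (\<pi> t) :: complex)"
    using surj by (intro injI) (metis ext surjD)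
  then have "inj_on (map_sum (\<lambda>u. u) (\<lambda>f s t. f (\<pi> s) (\<pi> t))) (carrier E)"
    by (intro inj_on_subset[OF sum.inj_map]) auto
  from amenable_derivation[OF amenable nonneg(1) \<pi> D this]
  obtain y where y: "y \<in> carrier dual" and eq: "\<And>t x. t \<in> carrier T \<Longrightarrow> x \<in> carrier E \<Longrightarrow>
      D (\<pi> t) x = y (ract E x (\<pi> t)) - y (lact E (\<pi> t) x)"
    by blast
  have "D a = lact dual a y \<ominus>\<^bsub>dual\<^esub> ract dual y a" if a: "a \<in> carrier A" for a
  proof (rule dual_eqI)
    show "lact dual a y \<ominus>\<^bsub>dual\<^esub> ract dual y a \<in> carrier dual"
      by (rule D.M.minus_closed) (use D.lact(1) D.ract(1) a y in auto)
    fix x assume x: "x \<in> carrier E"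
    obtain t where "t \<in> carrier T" "a = \<pi> t"
      using onto a by blast
    then have "D a x = lact dual a y x - ract dual y a x"
      using eq x by simp
    also have "\<dots> = (lact dual a y \<ominus>\<^bsub>dual\<^esub> ract dual y a) x"
      by (rule dual_minus_apply[symmetric]) (use D.lact(1) D.ract(1) a y x in \<open>simp_all del: dual_ops\<close>)
    finally show "D a x = (lact dual a y \<ominus>\<^bsub>dual\<^esub> ract dual y a) x" .
  qed (use DA a in auto)
  then show "inner_derivation A dual D"
    using y unfolding inner_derivation_def by blast
qed

section \<open>The Hahn-Banach theorem\<close>

context normed_space
begin

definition sublinear :: "('e \<Rightarrow> real) \<Rightarrow> bool" where
  "sublinear q \<longleftrightarrow>
     (\<forall>x\<in>carrier E. \<forall>y\<in>carrier E. q (x \<oplus>\<^bsub>E\<^esub> y) \<le> q x + q y) \<and>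
     (\<forall>r>0. \<forall>x\<in>carrier E. q (complex_of_real r \<odot>\<^bsub>E\<^esub> x) \<le> r * q x)"

lemma
  assumes "sublinear q"
  shows sublinear_add: "x \<in> carrier E \<Longrightarrow> y \<in> carrier E \<Longrightarrow> q (x \<oplus>\<^bsub>E\<^esub> y) \<le> q x + q y"
    and sublinear_smult: "r > 0 \<Longrightarrow> x \<in> carrier E \<Longrightarrow> q (complex_of_real r \<odot>\<^bsub>E\<^esub> x) \<le> r * q x"
  using assms unfolding sublinear_def by blast+

lemma sublinear_smult_eq:
  assumes q: "sublinear q" and r: "r > 0" and x: "x \<in> carrier E"
  shows "q (complex_of_real r \<odot>\<^bsub>E\<^esub> x) = r * q x"
proof (rule antisym[OF sublinear_smult[OF assms]])
  have "q x = q (complex_of_real (1 / r) \<odot>\<^bsub>E\<^esub> (complex_of_real r \<odot>\<^bsub>E\<^esub> x))"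
    using r x by (simp add: smult_smult flip: of_real_mult del: of_real_divide)
  also have "\<dots> \<le> 1 / r * q (complex_of_real r \<odot>\<^bsub>E\<^esub> x)"
    using r x by (intro sublinear_smult q) auto
  finally show "r * q x \<le> q (complex_of_real r \<odot>\<^bsub>E\<^esub> x)"
    using r by (simp add: field_simps)
qed

lemma sublinear_zero: "sublinear q \<Longrightarrow> 0 \<le> q \<zero>\<^bsub>E\<^esub>"
  using sublinear_add[of q "\<zero>\<^bsub>E\<^esub>" "\<zero>\<^bsub>E\<^esub>"] by simp

lemma sublinear_neg:
  assumes "sublinear q" "x \<in> carrier E"
  shows "- q (\<ominus>\<^bsub>E\<^esub> x) \<le> q x"
  using sublinear_add[OF assms(1), of x "\<ominus>\<^bsub>E\<^esub> x"] sublinear_zero[OF assms(1)] assms(2)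
  by (simp add: M.r_neg)

lemma sublinear_norm: "sublinear (nrm E)"
  unfolding sublinear_def using norm_triangle norm_smult by simp

text \<open>Replacing \<open>q\<close> by \<open>tilt y q\<close> lowers it as far as possible in the direction \<open>-y\<close> while keeping it
  sublinear: taking \<open>t = 1\<close>, the new value at \<open>x = -y\<close> is at most \<open>q 0 - q y\<close>. The construction is used
  twice: with \<open>q\<close> the norm, so that a functional below it is large at \<open>y\<close>, and with \<open>q\<close> minimal,
  where it changes nothing and thereby forces additivity.\<close>

definition tilt :: "'e \<Rightarrow> ('e \<Rightarrow> real) \<Rightarrow> 'e \<Rightarrow> real" where
  "tilt y q x = (INF t\<in>{0..}. q (x \<oplus>\<^bsub>E\<^esub> complex_of_real t \<odot>\<^bsub>E\<^esub> y) - t * q y)"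

lemma tilt_ge:
  assumes "\<And>t. t \<ge> 0 \<Longrightarrow> c \<le> q (x \<oplus>\<^bsub>E\<^esub> complex_of_real t \<odot>\<^bsub>E\<^esub> y) - t * q y"
  shows "c \<le> tilt y q x"
  unfolding tilt_def using assms by (intro cINF_greatest) auto

lemma tilt_le:
  assumes q: "sublinear q" and x: "x \<in> carrier E" and y: "y \<in> carrier E" and "t \<ge> 0"
  shows "tilt y q x \<le> q (x \<oplus>\<^bsub>E\<^esub> complex_of_real t \<odot>\<^bsub>E\<^esub> y) - t * q y"
proof -
  have "- q (\<ominus>\<^bsub>E\<^esub> x) \<le> q (x \<oplus>\<^bsub>E\<^esub> complex_of_real t \<odot>\<^bsub>E\<^esub> y) - t * q y" if "t \<ge> 0" for t
  proof -
    have "t * q y \<le> q (complex_of_real t \<odot>\<^bsub>E\<^esub> y)"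
      using sublinear_smult_eq[OF q, of t y] sublinear_zero[OF q] that y by (cases "t = 0") auto
    also have "\<dots> = q (\<ominus>\<^bsub>E\<^esub> x \<oplus>\<^bsub>E\<^esub> (x \<oplus>\<^bsub>E\<^esub> complex_of_real t \<odot>\<^bsub>E\<^esub> y))"
      using x y by (simp add: M.a_assoc[symmetric] M.l_neg)
    also have "\<dots> \<le> q (\<ominus>\<^bsub>E\<^esub> x) + q (x \<oplus>\<^bsub>E\<^esub> complex_of_real t \<odot>\<^bsub>E\<^esub> y)"
      using x y by (intro sublinear_add q) auto
    finally show ?thesis by simp
  qed
  then have "bdd_below ((\<lambda>t. q (x \<oplus>\<^bsub>E\<^esub> complex_of_real t \<odot>\<^bsub>E\<^esub> y) - t * q y) ` {0..})"
    by (intro bdd_belowI2[where m = "- q (\<ominus>\<^bsub>E\<^esub> x)"]) auto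
  then show ?thesis
    unfolding tilt_def using \<open>t \<ge> 0\<close> by (intro cINF_lower) auto
qed

lemma sublinear_tilt:
  assumes q: "sublinear q" and y: "y \<in> carrier E"
  shows "sublinear (tilt y q)"
  unfolding sublinear_def
proof (intro conjI ballI allI impI)
  fix x x' assume x: "x \<in> carrier E" "x' \<in> carrier E"
  have *: "tilt y q (x \<oplus>\<^bsub>E\<^esub> x') \<le> (q (x \<oplus>\<^bsub>E\<^esub> complex_of_real s \<odot>\<^bsub>E\<^esub> y) - s * q y)
      + (q (x' \<oplus>\<^bsub>E\<^esub> complex_of_real t \<odot>\<^bsub>E\<^esub> y) - t * q y)" if "s \<ge> 0" "t \<ge> 0" for s t
  proof -
    have "tilt y q (x \<oplus>\<^bsub>E\<^esub> x') \<le> q ((x \<oplus>\<^bsub>E\<^esub> x') \<oplus>\<^bsub>E\<^esub> complex_of_real (s + t) \<odot>\<^bsub>E\<^esub> y) - (s + t) * q y"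
      using x y that by (intro tilt_le q) auto
    also have "(x \<oplus>\<^bsub>E\<^esub> x') \<oplus>\<^bsub>E\<^esub> complex_of_real (s + t) \<odot>\<^bsub>E\<^esub> y =
        (x \<oplus>\<^bsub>E\<^esub> complex_of_real s \<odot>\<^bsub>E\<^esub> y) \<oplus>\<^bsub>E\<^esub> (x' \<oplus>\<^bsub>E\<^esub> complex_of_real t \<odot>\<^bsub>E\<^esub> y)"
      using x y by (simp add: smult_add_left M.a_ac)
    also have "q \<dots> \<le> q (x \<oplus>\<^bsub>E\<^esub> complex_of_real s \<odot>\<^bsub>E\<^esub> y) + q (x' \<oplus>\<^bsub>E\<^esub> complex_of_real t \<odot>\<^bsub>E\<^esub> y)"
      using x y by (intro sublinear_add q) auto
    finally show ?thesis by (simp add: algebra_simps)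
  qed
  have "tilt y q (x \<oplus>\<^bsub>E\<^esub> x') - (q (x' \<oplus>\<^bsub>E\<^esub> complex_of_real t \<odot>\<^bsub>E\<^esub> y) - t * q y) \<le> tilt y q x"
    if "t \<ge> 0" for t
    by (rule tilt_ge) (use * that in fastforce)
  then have "tilt y q (x \<oplus>\<^bsub>E\<^esub> x') - tilt y q x \<le> tilt y q x'"
    by (intro tilt_ge) fastforce
  then show "tilt y q (x \<oplus>\<^bsub>E\<^esub> x') \<le> tilt y q x + tilt y q x'" by simp
next
  fix r :: real and x assume r: "r > 0" and x: "x \<in> carrier E"
  have "tilt y q (complex_of_real r \<odot>\<^bsub>E\<^esub> x) / r \<le> tilt y q x"
  proof (rule tilt_ge)
    fix t :: real assume t: "t \<ge> 0"
    have "tilt y q (complex_of_real r \<odot>\<^bsub>E\<^esub> x)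
        \<le> q (complex_of_real r \<odot>\<^bsub>E\<^esub> x \<oplus>\<^bsub>E\<^esub> complex_of_real (r * t) \<odot>\<^bsub>E\<^esub> y) - (r * t) * q y"
      using x y r t by (intro tilt_le q) auto
    also have "complex_of_real r \<odot>\<^bsub>E\<^esub> x \<oplus>\<^bsub>E\<^esub> complex_of_real (r * t) \<odot>\<^bsub>E\<^esub> y
        = complex_of_real r \<odot>\<^bsub>E\<^esub> (x \<oplus>\<^bsub>E\<^esub> complex_of_real t \<odot>\<^bsub>E\<^esub> y)"
      using x y by (simp add: smult_add_right smult_smult)
    also have "q \<dots> = r * q (x \<oplus>\<^bsub>E\<^esub> complex_of_real t \<odot>\<^bsub>E\<^esub> y)"
      using x y r by (intro sublinear_smult_eq q) auto
    finally show "tilt y q (complex_of_real r \<odot>\<^bsub>E\<^esub> x) / r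
        \<le> q (x \<oplus>\<^bsub>E\<^esub> complex_of_real t \<odot>\<^bsub>E\<^esub> y) - t * q y"
      using r by (simp add: field_simps)
  qed
  then show "tilt y q (complex_of_real r \<odot>\<^bsub>E\<^esub> x) \<le> r * tilt y q x"
    using r by (simp add: field_simps)
qed

text \<open>Zorn's lemma: on a chain of sublinear functions below \<open>p\<close> the pointwise infimum is finite, as
  \<open>q x \<ge> - q (- x) \<ge> - p (- x)\<close>, and it is sublinear because of any two members one is the
  smaller. Functions are cut to zero off the carrier so that their pointwise order is
  antisymmetric.\<close>

lemma minimal_sublinear:
  assumes p: "sublinear p"
  obtains q where "sublinear q" "\<And>x. x \<in> carrier E \<Longrightarrow> q x \<le> p x"
    "\<And>q' x. sublinear q' \<Longrightarrow> (\<And>x. x \<in> carrier E \<Longrightarrow> q' x \<le> q x) \<Longrightarrow> x \<in> carrier E \<Longrightarrow> q' x = q x"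
proof -
  define cut where "cut q = (\<lambda>x. if x \<in> carrier E then q x else (0::real))" for q
  have cut_sublinear: "sublinear (cut q)" if "sublinear q" for q
    using that by (auto simp: sublinear_def cut_def)
  define S where "S = {q. sublinear q \<and> q \<le> cut p \<and> cut q = q}"
  define P :: "('e \<Rightarrow> real) \<Rightarrow> ('e \<Rightarrow> real) \<Rightarrow> bool" where "P q r \<longleftrightarrow> r \<le> q" for q r
  have "\<exists>m\<in>S. \<forall>a\<in>S. P m a \<longrightarrow> a = m"
  proof (rule predicate_Zorn)
    show "partial_order_on S (relation_of P S)"
      by (rule partial_order_on_relation_ofI) (auto simp: P_def)
    fix C assume "C \<in> Chains (relation_of P S)"
    then have CS: "C \<subseteq> S" and chain: "\<And>q r. q \<in> C \<Longrightarrow> r \<in> C \<Longrightarrow> q \<le> r \<or> r \<le> q"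
      by (auto simp: Chains_def relation_of_def P_def)
    show "\<exists>u\<in>S. \<forall>a\<in>C. P a u"
    proof (cases "C = {}")
      case True
      have "cut p \<in> S"
        using cut_sublinear[OF p] by (auto simp: S_def cut_def fun_eq_iff)
      then show ?thesis
        using True by blast
    next
      case False
      then obtain q0 where q0: "q0 \<in> C" by blast
      define u where "u = cut (\<lambda>x. INF q\<in>C. q x)"
      have Cq: "sublinear q" "q \<le> cut p" "cut q = q" if "q \<in> C" for q
        using CS that by (auto simp: S_def)
      have lower: "- p (\<ominus>\<^bsub>E\<^esub> x) \<le> q x" if "q \<in> C" "x \<in> carrier E" for q x
        using sublinear_neg[OF Cq(1)[OF that(1)] that(2)] le_funD[OF Cq(2)[OF that(1)], of "\<ominus>\<^bsub>E\<^esub> x"] that(2)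
        by (simp add: cut_def)
      have u_le: "u x \<le> q x" if "q \<in> C" "x \<in> carrier E" for q x
        using that lower by (auto simp: u_def cut_def intro!: cINF_lower bdd_belowI2)
      have u_ge: "c \<le> u x" if "\<And>q. q \<in> C \<Longrightarrow> c \<le> q x" "x \<in> carrier E" for c x
        using that False by (auto simp: u_def cut_def intro!: cINF_greatest)
      have "sublinear u"
        unfolding sublinear_def
      proof (intro conjI ballI allI impI)
        fix x y assume xy: "x \<in> carrier E" "y \<in> carrier E"
        have *: "u (x \<oplus>\<^bsub>E\<^esub> y) \<le> q x + r y" if qr: "q \<in> C" "r \<in> C" for q r
          using chain[OF qr]
        proof
          assume "q \<le> r"
          then show ?thesis
            using u_le[OF qr(1), of "x \<oplus>\<^bsub>E\<^esub> y"] sublinear_add[OF Cq(1)[OF qr(1)] xy] xy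
              le_funD[of q r y] by simp
        next
          assume "r \<le> q"
          then show ?thesis
            using u_le[OF qr(2), of "x \<oplus>\<^bsub>E\<^esub> y"] sublinear_add[OF Cq(1)[OF qr(2)] xy] xy
              le_funD[of r q x] by simp
        qed
        have "u (x \<oplus>\<^bsub>E\<^esub> y) - r y \<le> u x" if "r \<in> C" for r
          by (rule u_ge) (use * that xy in fastforce)+
        then have "u (x \<oplus>\<^bsub>E\<^esub> y) - u x \<le> u y"
          by (intro u_ge) (use xy in fastforce)+
        then show "u (x \<oplus>\<^bsub>E\<^esub> y) \<le> u x + u y" by simp
      next
        fix r :: real and x assume r: "r > 0" and x: "x \<in> carrier E"
        have "u (complex_of_real r \<odot>\<^bsub>E\<^esub> x) / r \<le> u x"
        proof (rule u_ge)
          fix q assume "q \<in> C"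
          then show "u (complex_of_real r \<odot>\<^bsub>E\<^esub> x) / r \<le> q x"
            using u_le[of q "complex_of_real r \<odot>\<^bsub>E\<^esub> x"] sublinear_smult[OF Cq(1), of q r x] r x
            by (simp add: field_simps)
        qed fact
        then show "u (complex_of_real r \<odot>\<^bsub>E\<^esub> x) \<le> r * u x"
          using r by (simp add: field_simps)
      qed
      moreover have "u \<le> q" if "q \<in> C" for q
      proof (rule le_funI)
        fix x show "u x \<le> q x"
          using u_le[OF that, of x] fun_cong[OF Cq(3)[OF that], of x]
          by (cases "x \<in> carrier E") (auto simp: u_def cut_def)
      qed
      moreover have "cut u = u"
        by (auto simp: u_def cut_def)
      ultimately show ?thesis
        using Cq(2)[OF q0] q0 unfolding S_def P_def by (intro bexI[of _ u]) (auto intro: order_trans)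
    qed
  qed
  then obtain q where q: "sublinear q" "q \<le> cut p" "cut q = q"
    and min: "\<And>r. r \<in> S \<Longrightarrow> r \<le> q \<Longrightarrow> r = q"
    unfolding S_def P_def by blast
  show ?thesis
  proof (rule that)
    show "q x \<le> p x" if "x \<in> carrier E" for x
      using le_funD[OF q(2), of x] that by (simp add: cut_def)
    fix q' x assume q': "sublinear q'" "\<And>x. x \<in> carrier E \<Longrightarrow> q' x \<le> q x" and x: "x \<in> carrier E"
    have "cut q' x \<le> q x" for x
      using q'(2)[of x] fun_cong[OF q(3), of x] by (auto simp: cut_def)
    then have le: "cut q' \<le> q"
      by (rule le_funI)
    have "cut q' \<in> S"
      using cut_sublinear[OF q'(1)] order_trans[OF le q(2)] by (auto simp: S_def cut_def)
    then have "cut q' = q"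
      using le by (rule min)
    then show "q' x = q x"
      using x by (auto simp: cut_def)
  qed (fact q(1))
qed

text \<open>A minimal sublinear \<open>u\<close> is additive: \<open>tilt y u \<le> u\<close> is an equality, so
  \<open>u x = tilt y u x \<le> u (x + y) - u y\<close>. Starting below \<open>tilt x0 (nrm E)\<close> instead of the norm itself
  gives \<open>u (- x0) \<le> - nrm E x0\<close>.\<close>

lemma norming_real_functional:
  assumes x0: "x0 \<in> carrier E"
  obtains u where "\<And>x y. x \<in> carrier E \<Longrightarrow> y \<in> carrier E \<Longrightarrow> u (x \<oplus>\<^bsub>E\<^esub> y) = u x + u y"
    "\<And>r x. x \<in> carrier E \<Longrightarrow> u (complex_of_real r \<odot>\<^bsub>E\<^esub> x) = r * u x"
    "\<And>x. x \<in> carrier E \<Longrightarrow> \<bar>u x\<bar> \<le> nrm E x" "nrm E x0 \<le> u x0"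
proof -
  have p: "sublinear (tilt x0 (nrm E))"
    using sublinear_norm x0 by (rule sublinear_tilt)
  from minimal_sublinear[OF p] obtain u where u: "sublinear u"
    and le: "\<And>x. x \<in> carrier E \<Longrightarrow> u x \<le> tilt x0 (nrm E) x"
    and min: "\<And>q' x. sublinear q' \<Longrightarrow> (\<And>x. x \<in> carrier E \<Longrightarrow> q' x \<le> u x) \<Longrightarrow> x \<in> carrier E \<Longrightarrow> q' x = u x"
    by blast
  have add: "u (x \<oplus>\<^bsub>E\<^esub> y) = u x + u y" if xy: "x \<in> carrier E" "y \<in> carrier E" for x y
  proof (rule antisym)
    have "tilt y u x = u x"
    proof (rule min[OF sublinear_tilt[OF u xy(2)] _ xy(1)])
      fix z assume "z \<in> carrier E"
      then show "tilt y u z \<le> u z"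
        using tilt_le[OF u _ xy(2), of z 0] xy by simp
    qed
    then show "u x + u y \<le> u (x \<oplus>\<^bsub>E\<^esub> y)"
      using tilt_le[OF u xy, of 1] xy by simp
  qed (rule sublinear_add[OF u xy])
  have zero: "u \<zero>\<^bsub>E\<^esub> = 0"
    using add[of "\<zero>\<^bsub>E\<^esub>" "\<zero>\<^bsub>E\<^esub>"] by simp
  have neg: "u (\<ominus>\<^bsub>E\<^esub> x) = - u x" if "x \<in> carrier E" for x
    using add[of x "\<ominus>\<^bsub>E\<^esub> x"] that zero by (simp add: M.r_neg)
  have smult: "u (complex_of_real r \<odot>\<^bsub>E\<^esub> x) = r * u x" if x: "x \<in> carrier E" for r x
  proof -
    consider "r > 0" | "r = 0" | "r < 0" by linarith
    then show ?thesis
    proof cases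
      case 3
      have "complex_of_real r \<odot>\<^bsub>E\<^esub> x = \<ominus>\<^bsub>E\<^esub> (complex_of_real (- r) \<odot>\<^bsub>E\<^esub> x)"
        using x by (simp add: smult_smult flip: smult_minus_one)
      then show ?thesis
        using 3 x neg[of "complex_of_real (- r) \<odot>\<^bsub>E\<^esub> x"] sublinear_smult_eq[OF u, of "- r" x]
        by simp
    qed (use x zero sublinear_smult_eq[OF u] in auto)
  qed
  have le_norm: "u x \<le> nrm E x" if "x \<in> carrier E" for x
    using le[OF that] tilt_le[OF sublinear_norm that x0, of 0] that x0 by simp
  show ?thesis
  proof (rule that[OF add smult])
    show "\<bar>u x\<bar> \<le> nrm E x" if "x \<in> carrier E" for x
      using le_norm[OF that] le_norm[of "\<ominus>\<^bsub>E\<^esub> x"] neg[OF that] norm_uminus[OF that] that by simp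
    show "nrm E x0 \<le> u x0"
      using le[of "\<ominus>\<^bsub>E\<^esub> x0"] tilt_le[OF sublinear_norm _ x0, of "\<ominus>\<^bsub>E\<^esub> x0" 1] neg[OF x0] x0
      by (simp add: M.l_neg)
  qed
qed

end

text \<open>For complex scalars the real functional \<open>u\<close> is the real part of the complex linear functional
  \<open>x \<mapsto> u x - \<i> u (\<i> x)\<close>.\<close>

lemma (in dual_space) Hahn_Banach_separation:
  assumes x0: "x0 \<in> carrier E" "x0 \<noteq> \<zero>\<^bsub>E\<^esub>"
  shows "\<exists>f\<in>carrier dual. f x0 \<noteq> 0"
proof -
  obtain u where u: "\<And>x y. x \<in> carrier E \<Longrightarrow> y \<in> carrier E \<Longrightarrow> u (x \<oplus>\<^bsub>E\<^esub> y) = u x + u y"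
    "\<And>r x. x \<in> carrier E \<Longrightarrow> u (complex_of_real r \<odot>\<^bsub>E\<^esub> x) = r * u x"
    "\<And>x. x \<in> carrier E \<Longrightarrow> \<bar>u x\<bar> \<le> nrm E x" "nrm E x0 \<le> u x0"
    using norming_real_functional[OF x0(1)] by metis
  have pos: "u x0 > 0"
    using u(4) norm_nonneg[OF x0(1)] norm_eq_0[OF x0(1)] x0(2) by simp
  consider "K = \<real>" | "K = UNIV"
    using real_or_complex by blast
  then show ?thesis
  proof cases
    case 1
    have "(\<lambda>x\<in>carrier E. complex_of_real (u x)) \<in> carrier dual"
      by (rule dual_memI[where C = 1]) (use u 1 in \<open>auto elim!: Reals_cases\<close>)
    then show ?thesis
      using pos x0 by (intro bexI) auto
  next
    case 2
    have lin: "u (k \<odot>\<^bsub>E\<^esub> x) = Re k * u x + Im k * u (\<i> \<odot>\<^bsub>E\<^esub> x)" if x: "x \<in> carrier E" for k x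
    proof -
      have "k \<odot>\<^bsub>E\<^esub> x = complex_of_real (Re k) \<odot>\<^bsub>E\<^esub> x \<oplus>\<^bsub>E\<^esub> complex_of_real (Im k) \<odot>\<^bsub>E\<^esub> (\<i> \<odot>\<^bsub>E\<^esub> x)"
        using x 2 by (simp add: smult_smult mult.commute flip: smult_add_left complex_eq)
      then show ?thesis
        using u(1,2) x 2 by simp
    qed
    define f where "f = (\<lambda>x\<in>carrier E. Complex (u x) (- u (\<i> \<odot>\<^bsub>E\<^esub> x)))"
    have "f \<in> carrier dual"
    proof (rule dual_memI[where C = 2])
      fix k x assume x: "x \<in> carrier E"
      then show "f (k \<odot>\<^bsub>E\<^esub> x) = k * f x"
        using 2 by (simp add: f_def smult_smult lin[OF x, of k] lin[OF x, of "\<i> * k"] complex_eq_iff)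
    next
      fix x assume x: "x \<in> carrier E"
      have "cmod (f x) \<le> \<bar>u x\<bar> + \<bar>u (\<i> \<odot>\<^bsub>E\<^esub> x)\<bar>"
        using cmod_le[of "f x"] x by (simp add: f_def)
      then show "cmod (f x) \<le> 2 * nrm E x"
        using u(3)[OF x] u(3)[of "\<i> \<odot>\<^bsub>E\<^esub> x"] norm_smult[of \<i> x] x 2 by simp
    qed (use 2 u(1) in \<open>auto simp: f_def smult_add_right complex_eq_iff\<close>)
    moreover have "f x0 \<noteq> 0"
      using pos x0 by (simp add: f_def complex_eq_iff)
    ultimately show ?thesis by blast
  qed
qed

section \<open>Twisted triangular algebras\<close>

lemma banach_Aut_bounded_hom: "s \<in> banach_Aut K A \<Longrightarrow> bounded_hom K A A s"
  by (simp add: banach_Aut_def bounded_hom_def)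

lemma bounded_hom_closed: "bounded_hom K S A \<phi> \<Longrightarrow> s \<in> carrier S \<Longrightarrow> \<phi> s \<in> carrier A"
  unfolding bounded_hom_def by (rule bounded_linear_mapD(1)[OF conjunct1])

lemma bounded_hom_compose:
  assumes "bounded_hom K S A \<phi>" "bounded_hom K A B \<psi>" "\<And>a. a \<in> carrier A \<Longrightarrow> 0 \<le> nrm A a"
  shows "bounded_hom K S B (\<lambda>s. \<psi> (\<phi> s))"
  using assms bounded_linear_map_compose[of K S A \<phi> B \<psi>] bounded_hom_closed[OF assms(1)]
  by (auto simp: bounded_hom_def)

lemma twisted_triangular_simps [simp]:
  "carrier (twisted_triangular \<sigma> A B X) = carrier A \<times> carrier X \<times> carrier B"
  "add (twisted_triangular \<sigma> A B X) (a, x, b) (a', x', b') = (a \<oplus>\<^bsub>A\<^esub> a', x \<oplus>\<^bsub>X\<^esub> x', b \<oplus>\<^bsub>B\<^esub> b')"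
  "smult (twisted_triangular \<sigma> A B X) k (a, x, b) = (k \<odot>\<^bsub>A\<^esub> a, k \<odot>\<^bsub>X\<^esub> x, k \<odot>\<^bsub>B\<^esub> b)"
  "nrm (twisted_triangular \<sigma> A B X) (a, x, b) = nrm A a + nrm X x + nrm B b"
  "mult (twisted_triangular \<sigma> A B X) (a, x, b) (a', x', b') =
     (a \<otimes>\<^bsub>A\<^esub> a', lact X (fst \<sigma> a) x' \<oplus>\<^bsub>X\<^esub> ract X x (snd \<sigma> b'), b \<otimes>\<^bsub>B\<^esub> b')"
  by (simp_all add: twisted_triangular_def)

theorem mainTheorem3:
  fixes K :: "complex set"
    and A :: "'a nspace" and B :: "'b nspace" and X :: "('a, 'b, 'x) bimod"
    and \<sigma> :: "('a \<Rightarrow> 'a) \<times> ('b \<Rightarrow> 'b)"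
  assumes "K = \<real> \<or> K = UNIV"
    and "banach_algebra K A" and "banach_algebra K B" and "banach_bimodule K A B X"
    and "\<sigma> \<in> banach_Aut K A \<times> banach_Aut K B"
    and "amenable TYPE('u) K (twisted_triangular \<sigma> A B X)"
  shows "carrier X = {\<zero>\<^bsub>X\<^esub>} \<and> amenable TYPE('u) K A \<and> amenable TYPE('u) K B"
proof -
  define T where "T = twisted_triangular \<sigma> A B X"
  note K = assms(1)
  interpret A: normed_space K A
    using K assms(2) by (intro banach_normed_space) (auto simp: banach_algebra_def)
  interpret B: normed_space K B
    using K assms(3) by (intro banach_normed_space) (auto simp: banach_algebra_def)
  interpret X: bimodule K A B X
    by unfold_locales (fact K A.norm_nonneg B.norm_nonneg assms(4))+
  have amenable: "amenable TYPE('u) K T"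
    using assms(6) by (simp add: T_def)
  have nonneg: "0 \<le> nrm T t" if "t \<in> carrier T" for t
    using that A.norm_nonneg B.norm_nonneg X.norm_nonneg by (auto simp: T_def)
  have \<pi>\<^sub>A: "bounded_hom K T A fst"
    unfolding bounded_hom_def
  proof
    show "bounded_linear_map K T A fst"
      by (rule bounded_linear_mapI[where C = 1])
        (auto simp: T_def X.norm_nonneg B.norm_nonneg add_nonneg_nonneg)
  qed (auto simp: T_def)
  have \<pi>\<^sub>B: "bounded_hom K T B (\<lambda>t. snd (snd t))"
    unfolding bounded_hom_def
  proof
    show "bounded_linear_map K T B (\<lambda>t. snd (snd t))"
      by (rule bounded_linear_mapI[where C = 1])
        (auto simp: T_def X.norm_nonneg A.norm_nonneg add_nonneg_nonneg)
  qed (auto simp: T_def)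
  have "carrier A \<subseteq> fst ` carrier T"
    by (auto simp: T_def intro!: rev_image_eqI[of "(_, \<zero>\<^bsub>X\<^esub>, \<zero>\<^bsub>B\<^esub>)"])
  moreover have "surj (fst :: 'a \<times> 'x \<times> 'b \<Rightarrow> 'a)"
    by (rule surjI[of _ "\<lambda>a. (a, undefined)"]) simp
  ultimately have "amenable TYPE('u) K A"
    using amenable_image[OF K amenable nonneg A.norm_nonneg \<pi>\<^sub>A] by blast
  moreover have "carrier B \<subseteq> (\<lambda>t. snd (snd t)) ` carrier T"
    by (auto simp: T_def intro!: rev_image_eqI[of "(\<zero>\<^bsub>A\<^esub>, \<zero>\<^bsub>X\<^esub>, _)"])
  moreover have "surj (\<lambda>t :: 'a \<times> 'x \<times> 'b. snd (snd t))"
    by (rule surjI[of _ "\<lambda>b. (undefined, undefined, b)"]) simp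
  ultimately have "amenable TYPE('u) K A \<and> amenable TYPE('u) K B"
    using amenable_image[OF K amenable nonneg B.norm_nonneg \<pi>\<^sub>B] by blast
  \<comment> \<open>Every bounded functional is shown to vanish at the value \<open>x\<close> of the corner projection.\<close>
  moreover have "x = \<zero>\<^bsub>X\<^esub>" if x: "x \<in> carrier X" for x
  proof (rule ccontr)
    assume "x \<noteq> \<zero>\<^bsub>X\<^esub>"
    have \<sigma>: "bounded_hom K A A (fst \<sigma>)" "bounded_hom K B B (snd \<sigma>)"
      using assms(5) by (auto intro: banach_Aut_bounded_hom)
    note \<sigma>_in = bounded_hom_closed[OF \<sigma>(1)] bounded_hom_closed[OF \<sigma>(2)]
    have \<sigma>0: "fst \<sigma> \<zero>\<^bsub>A\<^esub> = \<zero>\<^bsub>A\<^esub>" "snd \<sigma> \<zero>\<^bsub>B\<^esub> = \<zero>\<^bsub>B\<^esub>"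
      using \<sigma> \<sigma>_in(1)[of "\<zero>\<^bsub>A\<^esub>"] \<sigma>_in(2)[of "\<zero>\<^bsub>B\<^esub>"]
        bounded_linear_mapD(3)[of K A A "fst \<sigma>" 0 "\<zero>\<^bsub>A\<^esub>"] bounded_linear_mapD(3)[of K B B "snd \<sigma>" 0 "\<zero>\<^bsub>B\<^esub>"]
      by (auto simp: bounded_hom_def)
    \<comment> \<open>The bimodule \<open>Y\<close> is \<open>X\<close> with the twisted actions \<open>\<sigma>\<^sub>A(a) x\<close> and \<open>x \<sigma>\<^sub>B(b)\<close> that occur in the
      product of \<open>T\<close>; this makes the projection to the corner a derivation.\<close>
    define \<phi> \<psi> where "\<phi> = (\<lambda>t :: 'a \<times> 'x \<times> 'b. fst \<sigma> (fst t))"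
      and "\<psi> = (\<lambda>t :: 'a \<times> 'x \<times> 'b. snd \<sigma> (snd (snd t)))"
    have \<phi>: "bounded_hom K T A \<phi>"
      unfolding \<phi>_def by (rule bounded_hom_compose[OF \<pi>\<^sub>A \<sigma>(1)]) (rule A.norm_nonneg)
    have \<psi>: "bounded_hom K T B \<psi>"
      unfolding \<psi>_def by (rule bounded_hom_compose[OF \<pi>\<^sub>B \<sigma>(2)]) (rule B.norm_nonneg)
    define Y where "Y = bimod_along (\<lambda>x. x) \<phi> \<psi> X"
    have inj: "inj_on (\<lambda>x. x) (carrier X)"
      by simp
    have Yb: "banach_bimodule K T T Y"
      unfolding Y_def by (rule X.banach_bimodule_along[OF inj \<phi> \<psi>])
    interpret Y: dual_bimodule K T Y
      by unfold_locales (fact K nonneg Yb)+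
    have Y: "carrier Y = carrier X" "\<zero>\<^bsub>Y\<^esub> = \<zero>\<^bsub>X\<^esub>"
      "\<And>x y. x \<in> carrier X \<Longrightarrow> y \<in> carrier X \<Longrightarrow> x \<oplus>\<^bsub>Y\<^esub> y = x \<oplus>\<^bsub>X\<^esub> y"
      "\<And>k x. x \<in> carrier X \<Longrightarrow> k \<odot>\<^bsub>Y\<^esub> x = k \<odot>\<^bsub>X\<^esub> x"
      "\<And>x. x \<in> carrier X \<Longrightarrow> nrm Y x = nrm X x"
      "\<And>t x. x \<in> carrier X \<Longrightarrow> lact Y t x = lact X (fst \<sigma> (fst t)) x"
      "\<And>t x. x \<in> carrier X \<Longrightarrow> ract Y x t = ract X x (snd \<sigma> (snd (snd t)))"
      unfolding Y_def \<phi>_def \<psi>_def using bimod_along_inj[OF inj] by (simp_all add: bimod_along_simps)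
    have d: "bounded_derivation K T Y (\<lambda>t. fst (snd t))"
      unfolding bounded_derivation_def
    proof
      show "bounded_linear_map K T Y (\<lambda>t. fst (snd t))"
        by (rule bounded_linear_mapI[where C = 1])
          (use A.norm_nonneg B.norm_nonneg in \<open>force simp: T_def Y\<close>)+
    qed (use \<sigma>_in X.lact(1) X.ract(1) in \<open>auto simp: T_def Y\<close>)
    have "lact X \<zero>\<^bsub>A\<^esub> z = \<zero>\<^bsub>X\<^esub>" "ract X z \<zero>\<^bsub>B\<^esub> = \<zero>\<^bsub>X\<^esub>" if "z \<in> carrier X" for z
      using X.lact(1)[of "\<zero>\<^bsub>A\<^esub>" z] X.ract(1)[of z "\<zero>\<^bsub>B\<^esub>"]
        X.lact(4)[of 0 "\<zero>\<^bsub>A\<^esub>" z] X.ract(5)[of 0 z "\<zero>\<^bsub>B\<^esub>"] that by auto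
    then have null: "lact Y (\<zero>\<^bsub>A\<^esub>, x, \<zero>\<^bsub>B\<^esub>) z = \<zero>\<^bsub>Y\<^esub>" "ract Y z (\<zero>\<^bsub>A\<^esub>, x, \<zero>\<^bsub>B\<^esub>) = \<zero>\<^bsub>Y\<^esub>"
      if "z \<in> carrier Y" for z
      using that by (simp_all add: Y \<sigma>0)
    \<comment> \<open>The derivation has values in the bidual of \<open>Y\<close>, so the bimodule to be embedded is the dual
      of \<open>Y\<close>, a set of functions on \<open>'x\<close>.\<close>
    define j :: "('x \<Rightarrow> complex) \<Rightarrow> 'u + ('a \<times> 'x \<times> 'b \<Rightarrow> 'a \<times> 'x \<times> 'b \<Rightarrow> complex)"
      where "j f = Inr (\<lambda>t _. f (fst (snd t)))" for f
    have "inj j"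
      by (rule injI) (auto simp: j_def fun_eq_iff)
    then have j: "inj_on j (carrier Y.dual)"
      by (rule inj_on_subset) simp
    have "(\<zero>\<^bsub>A\<^esub>, x, \<zero>\<^bsub>B\<^esub>) \<in> carrier T"
      using x by (simp add: T_def)
    then have "f (fst (snd (\<zero>\<^bsub>A\<^esub>, x, \<zero>\<^bsub>B\<^esub>))) = 0" if "f \<in> carrier Y.dual" for f
      using null that by (rule Y.amenable_derivation_vanishes[OF amenable d j])
    then have "f x = 0" if "f \<in> carrier Y.dual" for f
      using that by simp
    moreover obtain f where "f \<in> carrier Y.dual" "f x \<noteq> 0"
      using Y.Hahn_Banach_separation[of x] x \<open>x \<noteq> \<zero>\<^bsub>X\<^esub>\<close> by (auto simp: Y)
    ultimately show False by blast
  qed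
  ultimately show ?thesis
    using X.M.zero_closed by blast
qed

end
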